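(* Let $A\in\mathbb{R}^{n\times n}$, $B\in\mathbb{R}^{n\times 1}$ (single-input case, $m=1$), and let $Q\in\mathbb{R}^{n\times n}$, $Q\succeq 0$, and $R\in\mathbb{R}$, $R>0$, with $(A,B)$ stabilizable and $(A,\sqrt{Q})$ detectable. Consider the LTI system $\dot x=Ax+Bu$ with static state feedback $u=Kx$, $K\in\mathbb{R}^{1\times n}$, where $K$ is such that the closed loop is stable (all eigenvalues of $A+BK$ have negative real part), with zero initial state and with a unit impulse signal $\delta$ injected through the input channel, so that $x=x(K)=A_+(K)B\delta$ and $u=Kx$. Let $$J(K)=\int_0^\infty \tfrac12\left(x^TQx+u^TRu\right)dt .$$ Then the gradient of $J$ with respect to $K$ is $$\frac{dJ(K)}{dK}=\int_0^\infty x^TQ\,\frac{\partial x(K)}{\partial K}\,dt+\int_0^\infty u^TR\left(x^T+K\frac{\partial x(K)}{\partial K}\right)dt ,$$ where $$\frac{\partial x(K)}{\partial K}=\left[\left(\frac{\partial x_1(K)}{\partial K}\right)^T\ \left(\frac{\partial x_2(K)}{\partial K}\right)^T\ \cdots\ \left(\frac{\partial x_n(K)}{\partial K}\right)^T\right]^T\in\mathbb{R}^{n\times n},$$ and, for every $i=1,\dots,n$, $$\frac{\partial x_i(K)}{\partial K}=\left(A_+(K)B\,\delta\, e_i^TA_+(K)B\right)^T\in\mathbb{R}^{1\times n},$$ with $e_i\in\mathbb{R}^n$ the $i$th standard basis vector.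
   Context: $A_+(K)=(sI-A-BK)^{-1}$ is a transfer matrix. Mixed time/transform notation is used: for a stable rational transfer matrix $H(s)$ and a signal $w(t)$, $Hw$ denotes the time-domain output of the system with transfer matrix $H(s)$ driven by $w$ from zero initial conditions; in particular $H\delta$ is the impulse response of $H$. Thus $x=A_+(K)B\delta$ is the solution of $\dot x=(A+BK)x+B\delta$ started from zero, i.e. $x(t)=e^{(A+BK)t}B$ for $t>0$, and $x_i(K)=e_i^TA_+(K)B\delta$ is its $i$th component. The feedback signal $u=Kx$ does not include the injected impulse. The expression $A_+(K)B\,\delta\,e_i^TA_+(K)B$ denotes the ($n\times 1$ vector-valued) time-domain signal that is the impulse response of the transfer matrix $(sI-A-BK)^{-1}B\;e_i^T(sI-A-BK)^{-1}B$. $\partial x_i(K)/\partial K$ is, at each time $t$, the derivative of the scalar $x_i(K)(t)$ with respect to the entries of $K$, arranged in the same shape as $K$; $dJ/dK$ is likewise arranged in the shape of $K$ (so $f(K+\varepsilon\Delta K)=f(K)+\varepsilon\,\mathrm{Tr}((df/dK)^T\Delta K)+o(\varepsilon)$). *)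

theory Defs
  imports "HOL-Analysis.Analysis"
begin

abbreviation complex_matrix :: "real^'n^'m \<Rightarrow> complex^'n^'m"
  where "complex_matrix \<equiv> map_matrix complex_of_real"

definition pos_semidef :: "real^'n^'n \<Rightarrow> bool"
  where "pos_semidef Q \<longleftrightarrow> transpose Q = Q \<and> (\<forall>x. 0 \<le> x \<bullet> (Q *v x))"

definition matrix_sqrt :: "real^'n^'n \<Rightarrow> real^'n^'n"
  where "matrix_sqrt Q = (THE S. pos_semidef S \<and> S ** S = Q)"

definition hurwitz :: "real^'n^'n \<Rightarrow> bool"
  where "hurwitz M \<longleftrightarrow>
    (\<forall>l::complex. (\<exists>v. v \<noteq> 0 \<and> complex_matrix M *v v = l *s v) \<longrightarrow> Re l < 0)"

definition stabilizable :: "real^'n^'n \<Rightarrow> real^'m^'n \<Rightarrow> bool"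
  where "stabilizable A B \<longleftrightarrow> (\<exists>F::real^'n^'m. hurwitz (A + B ** F))"

definition detectable :: "real^'n^'n \<Rightarrow> real^'n^'p \<Rightarrow> bool"
  where "detectable A C \<longleftrightarrow> (\<exists>L::real^'p^'n. hurwitz (A + L ** C))"

text \<open>
  The signal \<open>H \<delta>\<close> for a strictly proper rational transfer matrix \<open>H\<close> (so that the response to an
  impulse is an ordinary function): the causal signal, continuous for positive times, whose Laplace
  transform is \<open>H\<close> on some right half plane. At time \<open>0\<close>, where the response may
  jump, we use the value \<open>0\<close>. Continuity for positive times singles out one function among those
  with the same transform.
\<close>

definition is_impulse_response :: "(complex \<Rightarrow> complex^'m^'n) \<Rightarrow> (real \<Rightarrow> real^'m^'n) \<Rightarrow> bool"
  where "is_impulse_response H h \<longleftrightarrow>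
    (\<forall>t\<le>0. h t = 0) \<and> continuous_on {0<..} h \<and>
    (\<exists>\<sigma>. \<forall>s. Re s > \<sigma> \<longrightarrow> (\<forall>i j.
       (\<lambda>t. exp (- s * of_real t) * of_real (h t $ i $ j)) absolutely_integrable_on {0..} \<and>
       integral {0..} (\<lambda>t. exp (- s * of_real t) * of_real (h t $ i $ j)) = H s $ i $ j))"

definition impulse_response :: "(complex \<Rightarrow> complex^'m^'n) \<Rightarrow> real \<Rightarrow> real^'m^'n"
  where "impulse_response H = (THE h. is_impulse_response H h)"

definition A_plus :: "real^'n^'n \<Rightarrow> real^'m^'n \<Rightarrow> real^'n^'m \<Rightarrow> complex \<Rightarrow> complex^'n^'n"
  where "A_plus A B K s = matrix_inv (mat s - complex_matrix (A + B ** K))"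

definition state :: "real^'n^'n \<Rightarrow> real^1^'n \<Rightarrow> real^'n^1 \<Rightarrow> real \<Rightarrow> real^1^'n"
  where "state A B K = impulse_response (\<lambda>s. A_plus A B K s ** complex_matrix B)"

definition feedback :: "real^'n^'n \<Rightarrow> real^1^'n \<Rightarrow> real^'n^1 \<Rightarrow> real \<Rightarrow> real"
  where "feedback A B K t = (K ** state A B K t) $ 1 $ 1"

definition running_cost ::
    "real^'n^'n \<Rightarrow> real^1^'n \<Rightarrow> real^'n^'n \<Rightarrow> real \<Rightarrow> real^'n^1 \<Rightarrow> real \<Rightarrow> real"
  where "running_cost A B Q R K t =
    1/2 * ((transpose (state A B K t) ** Q ** state A B K t) $ 1 $ 1
           + feedback A B K t * R * feedback A B K t)"

definition cost :: "real^'n^'n \<Rightarrow> real^1^'n \<Rightarrow> real^'n^'n \<Rightarrow> real \<Rightarrow> real^'n^1 \<Rightarrow> real"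
  where "cost A B Q R K = integral {0..} (running_cost A B Q R K)"

text \<open>
  Gradients of real functions of a matrix are taken with respect to the inner product of
  \<^typ>\<open>real^'n^'m\<close>, which is the trace inner product. Hence \<open>GDERIV f K :> G\<close> says that \<open>f\<close> is
  differentiable with \<open>f (K + D) = f K + Tr (G\<^sup>T D) + o(|D|)\<close>, where \<open>G\<close> has the shape of \<open>K\<close>.
\<close>

lemma inner_matrix_eq_trace: "D \<bullet> G = trace (transpose G ** D)" for D G :: "real^'n^'m"
  unfolding trace_def transpose_def matrix_matrix_mult_def inner_vec_def
  by simp (subst sum.swap, simp add: mult.commute)

definition gradient :: "(real^'n^'m \<Rightarrow> real) \<Rightarrow> real^'n^'m \<Rightarrow> real^'n^'m"
  where "gradient f K = (THE G. GDERIV f K :> G)"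

definition dstate :: "real^'n^'n \<Rightarrow> real^1^'n \<Rightarrow> real^'n^1 \<Rightarrow> real \<Rightarrow> real^'n^'n"
  where "dstate A B K t = (\<chi> i. gradient (\<lambda>K'. state A B K' t $ i $ 1) K $ 1)"

end

theory Submission
  imports Defs "HOL-Computational_Algebra.Fundamental_Theorem_Algebra"
begin

text \<open>
  Impulse responses are identified by solving a linear differential equation, transforming it
  and using the injectivity of the Laplace transform. Let \<open>\<phi>\<close> be the closed-loop state and \<open>S d\<close> its
  formal derivative in the direction \<open>d\<close>. The differences \<open>\<psi> - \<phi>\<close> and \<open>\<psi> - \<phi> - S d\<close>, with \<open>\<psi>\<close> the
  state for the gain \<open>K + d\<close>, solve the equation \<open>y' = (A + B K) y + g\<close> with exponentially decaying
  \<open>g\<close>, hence are bounded by \<open>C |d| exp (- a t)\<close> and \<open>C |d|\<^sup>2 exp (- a t)\<close>. As the second bound is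
  integrable in \<open>t\<close>, the expansion of the integrand passes to the cost. The decay itself comes
  from a polynomial that annihilates \<open>A + B K\<close> and has only eigenvalues as roots: its linear
  factors are removed one at a time, each step being a scalar equation.
\<close>

text \<open>The obstacle is uniformity: the cost for \<open>K + d\<close> needs a decay estimate
  whose constants do not depend on \<open>d\<close>, and stability of each perturbed matrix alone
  would not give one. The perturbed closed loop is therefore never analysed spectrally. As there is
  a single input, the perturbation enters as the scalar \<open>d \<bullet> \<psi>\<close> times the
  fixed column of \<open>B\<close>, and it is treated as forcing of the unperturbed equation.
  Accordingly the decay estimate fixes its constants before the solution and the forcing, and it
  works on bounded intervals, because nothing is known at first about \<psi> at infinity. For small
  \<open>d\<close> the forcing can be absorbed into the left-hand side. Each use of the estimate on
  a response from rest then contributes one factor |d|; this is the source of the orders one and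
  two.\<close>

subsection \<open>Linear differential equations and Laplace transforms\<close>

text \<open>The solution is the exponential series of \<open>t L\<close> applied to
  \<open>y0\<close>, differentiated coordinate by coordinate as a scalar power series. The space is
  general because the lemma is later applied to pairs of a vector and a matrix. The growth bound
  gives the transforms a half plane of convergence.\<close>

lemma linear_ode_solution:
  fixes L :: "'a::euclidean_space \<Rightarrow> 'a"
  assumes "linear L"
  shows "\<exists>y \<beta>. y 0 = y0 \<and> (\<forall>t. (y has_vector_derivative L (y t)) (at t))
     \<and> (\<forall>t\<ge>0. norm (y t) \<le> norm y0 * exp (\<beta> * t))"
proof -
  have bl: "bounded_linear L" using assms by (simp add: linear_linear)
  obtain \<beta> where \<beta>: "\<beta> > 0" "\<And>x. norm (L x) \<le> norm x * \<beta>"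
    using bounded_linear.pos_bounded[OF bl] by auto
  have pow: "norm ((L ^^ k) y0) \<le> \<beta> ^ k * norm y0" for k
  proof (induction k)
    case (Suc k)
    have "norm (L ((L ^^ k) y0)) \<le> norm ((L ^^ k) y0) * \<beta>" by (rule \<beta>)
    also have "\<dots> \<le> (\<beta> ^ k * norm y0) * \<beta>" using Suc \<beta>(1) by (simp add: mult_right_mono)
    finally show ?case by (simp add: mult_ac)
  qed simp
  define f where "f t k = (t ^ k / fact k) *\<^sub>R (L ^^ k) y0" for t :: real and k
  define y where "y t = (\<Sum>k. f t k)" for t
  have nf: "norm (f t k) \<le> norm y0 * ((\<beta> * \<bar>t\<bar>) ^ k /\<^sub>R fact k)" for t k
  proof -
    have "norm (f t k) \<le> \<bar>t\<bar> ^ k / fact k * (\<beta> ^ k * norm y0)"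
      unfolding f_def using mult_left_mono[OF pow[of k], of "\<bar>t\<bar> ^ k / fact k"]
      by (simp add: power_abs)
    then show ?thesis by (simp add: power_mult_distrib divide_inverse mult_ac)
  qed
  have se: "summable (\<lambda>k. norm y0 * ((\<beta> * \<bar>t\<bar>) ^ k /\<^sub>R fact k))" for t
    by (intro summable_mult summable_exp_generic)
  have sn: "summable (\<lambda>k. norm (f t k))" for t
    by (rule summable_comparison_test[OF _ se[of t]]) (use nf in auto)
  have sf: "summable (f t)" for t
    by (rule summable_norm_cancel[OF sn])
  have L_sum: "L (y t) = (\<Sum>k. L (f t k))" for t
    unfolding y_def by (rule bounded_linear.suminf[OF bl sf])
  have der: "((\<lambda>t. y t \<bullet> b) has_real_derivative L (y t) \<bullet> b) (at t)" for b t
  proof -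
    define c where "c k = ((L ^^ k) y0 \<bullet> b) / fact k" for k
    have fc: "f t k \<bullet> b = c k * t ^ k" for t k
      by (simp add: f_def c_def)
    have sc: "summable (\<lambda>k. c k * t ^ k)" for t
      using bounded_linear.summable[OF bounded_linear_inner_left[of b] sf[of t]]
      by (simp add: fc)
    have yb: "y t \<bullet> b = (\<Sum>k. c k * t ^ k)" for t
      unfolding y_def using bounded_linear.suminf[OF bounded_linear_inner_left[of b] sf[of t]]
      by (simp add: fc)
    have "L (f t k) \<bullet> b = diffs c k * t ^ k" for k
      by (simp add: f_def c_def diffs_def linear_cmul[OF assms] divide_simps)
    then have "L (y t) \<bullet> b = (\<Sum>k. diffs c k * t ^ k)"
      unfolding L_sum
      using bounded_linear.suminf[OF bounded_linear_inner_left[of b]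
          bounded_linear.summable[OF bl sf[of t]]] by simp
    then show ?thesis
      using termdiffs_strong_converges_everywhere[OF sc, of t] by (simp add: yb)
  qed
  have "(y has_vector_derivative L (y t)) (at t)" for t
    unfolding has_vector_derivative_def has_derivative_componentwise_within[of y]
    using der[unfolded has_field_derivative_def] by (simp add: mult.commute[of _ "_ \<bullet> _"])
  moreover have "y 0 = y0"
    unfolding y_def f_def using powser_sums_zero_iff
    by (subst suminf_finite[of "{0}"]) auto
  moreover have "norm (y t) \<le> norm y0 * exp (\<beta> * t)" if "t \<ge> 0" for t
  proof -
    have "norm (y t) \<le> (\<Sum>k. norm (f t k))"
      unfolding y_def by (rule summable_norm[OF sn])
    also have "\<dots> \<le> (\<Sum>k. norm y0 * ((\<beta> * \<bar>t\<bar>) ^ k /\<^sub>R fact k))"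
      by (rule suminf_le[OF nf sn se])
    also have "\<dots> = norm y0 * exp (\<beta> * \<bar>t\<bar>)"
      by (subst suminf_mult[OF summable_exp_generic]) (simp add: exp_def)
    finally show ?thesis using that by simp
  qed
  ultimately show ?thesis by blast
qed

text \<open>Signals may jump at 0, so continuity is available on the open half line only, while the
  transforms and the cost integrate over the closed one. These two facts are the premises for
  changing between the domains.\<close>

lemma negligible_half_line_diff:
  "negligible {t \<in> {0::real..} - {0<..}. P t}" "negligible {t \<in> {0<..} - {0::real..}. P t}"
  by (auto intro: negligible_subset[of "{0}"])

text \<open>Domination by an exponential. The second part later turns the pointwise second-order
  bound on the cost integrand into a bound on the remainder of the cost.\<close>

lemma absolutely_integrable_exp_bound:
  fixes f :: "real \<Rightarrow> 'a::euclidean_space"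
  assumes "continuous_on {0<..} f" "a > 0" "\<And>t. t > 0 \<Longrightarrow> norm (f t) \<le> C * exp (- a * t)"
  shows "f absolutely_integrable_on {0..}"
    and "norm (integral {0..} f) \<le> C / a"
proof -
  have E: "((\<lambda>t. C * exp (- a * t)) has_integral C * (exp (- a * 0) / a)) {0..}"
    by (intro has_integral_mult_right has_integral_exp_minus_to_infinity assms)
  have E': "((\<lambda>t. C * exp (- a * t)) has_integral C / a) {0<..}"
    using E by (subst has_integral_spike_set_eq[OF negligible_half_line_diff(2,1)]) simp
  have "f absolutely_integrable_on {0<..}"
    by (rule measurable_bounded_by_integrable_imp_absolutely_integrable
        [OF continuous_imp_measurable_on_sets_lebesgue[OF assms(1)] _ has_integral_integrable[OF E']])
       (use assms in auto)
  moreover from this have "norm (integral {0<..} f) \<le> integral {0<..} (\<lambda>t. C * exp (- a * t))"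
    by (intro integral_norm_bound_integral set_lebesgue_integral_eq_integral has_integral_integrable[OF E'])
      (use assms in auto)
  ultimately show "f absolutely_integrable_on {0..}" "norm (integral {0..} f) \<le> C / a"
    unfolding absolutely_integrable_spike_set_eq[OF negligible_half_line_diff, of f]
      integral_spike_set[OF negligible_half_line_diff, of f] integral_unique[OF E'] .
qed

section \<open>Laplace transforms of functions of exponential growth\<close>

definition laplace :: "(real \<Rightarrow> real) \<Rightarrow> complex \<Rightarrow> complex"
  where "laplace f s = integral {0..} (\<lambda>t. exp (- s * of_real t) * of_real (f t))"

lemma laplace_integrable:
  assumes "continuous_on {0<..} f" "\<And>t. t > 0 \<Longrightarrow> \<bar>f t\<bar> \<le> C * exp (\<beta> * t)" "Re s > \<beta>"
  shows "(\<lambda>t. exp (- s * of_real t) * of_real (f t)) absolutely_integrable_on {0..}"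
proof (rule absolutely_integrable_exp_bound)
  show "continuous_on {0<..} (\<lambda>t. exp (- s * of_real t) * of_real (f t))"
    by (intro continuous_intros assms)
  show "Re s - \<beta> > 0" using assms by simp
  fix t :: real assume t: "t > 0"
  have "norm (exp (- s * of_real t) * of_real (f t)) = exp (- Re s * t) * \<bar>f t\<bar>"
    by (simp add: norm_mult)
  also have "\<dots> \<le> exp (- Re s * t) * (C * exp (\<beta> * t))"
    by (intro mult_left_mono assms t) simp
  also have "\<dots> = C * exp (- (Re s - \<beta>) * t)"
    by (simp add: algebra_simps flip: exp_add)
  finally show "norm (exp (- s * of_real t) * of_real (f t)) \<le> C * exp (- (Re s - \<beta>) * t)" .
qed

lemma laplace_sum:
  assumes "\<And>j. j \<in> J \<Longrightarrow> (\<lambda>t. exp (- s * of_real t) * of_real (f j t)) absolutely_integrable_on {0..}"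
    and "finite J"
  shows "laplace (\<lambda>t. \<Sum>j\<in>J. c j * f j t) s = (\<Sum>j\<in>J. of_real (c j) * laplace (f j) s)"
proof -
  have "laplace (\<lambda>t. \<Sum>j\<in>J. c j * f j t) s
      = integral {0..} (\<lambda>t. \<Sum>j\<in>J. of_real (c j) * (exp (- s * of_real t) * of_real (f j t)))"
    unfolding laplace_def by (simp add: sum_distrib_left mult_ac)
  also have "\<dots> = (\<Sum>j\<in>J. integral {0..} (\<lambda>t. of_real (c j) * (exp (- s * of_real t) * of_real (f j t))))"
    using assms by (intro integral_sum integrable_on_cmult_left set_lebesgue_integral_eq_integral)
  also have "\<dots> = (\<Sum>j\<in>J. of_real (c j) * laplace (f j) s)"
    unfolding laplace_def by simp
  finally show ?thesis .
qed

text \<open>Integration by parts: the derivative of \<open>exp (- s t) f t\<close> is integrated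
  over \<open>{0..T}\<close>, and the boundary term at \<open>T\<close> vanishes in the limit
  because \<open>Re s > \<beta>\<close>.\<close>

lemma laplace_derivative:
  assumes der: "\<And>t. (f has_real_derivative f' t) (at t)" and cont: "continuous_on UNIV f'"
    and f: "\<And>t. t \<ge> 0 \<Longrightarrow> \<bar>f t\<bar> \<le> C * exp (\<beta> * t)"
    and f': "\<And>t. t \<ge> 0 \<Longrightarrow> \<bar>f' t\<bar> \<le> C' * exp (\<beta> * t)" and s: "Re s > \<beta>"
  shows "laplace f' s = s * laplace f s - of_real (f 0)"
proof -
  let ?E = "\<lambda>f t. exp (- s * of_real t) * complex_of_real (f t)"
  define h where "h t = ?E f' t - s * ?E f t" for t
  have "continuous_on UNIV f"
    using der by (auto intro!: continuous_at_imp_continuous_on DERIV_isCont)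
  then have ai: "?E f absolutely_integrable_on {0..}" "?E f' absolutely_integrable_on {0..}"
    by (rule laplace_integrable[OF continuous_on_subset f s]; simp)
      (rule laplace_integrable[OF continuous_on_subset[OF cont] f' s]; simp)
  then have hi: "h absolutely_integrable_on {0..}"
    unfolding h_def by (intro set_integral_diff) auto
  have hval: "integral {0..} h = laplace f' s - s * laplace f s"
    using ai[THEN set_lebesgue_integral_eq_integral(1)]
      and set_lebesgue_integral_eq_integral(1)[OF set_integrable_mult_right[OF ai(1), of s]]
    unfolding h_def laplace_def by (subst integral_diff) auto
  have dh: "(?E f has_vector_derivative h t) (at t)" for t
  proof -
    have "((\<lambda>z. exp (- s * z)) has_field_derivative (- s * exp (- s * of_real t))) (at (of_real t))"
      by (auto intro!: derivative_eq_intros)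
    then have "((\<lambda>t. exp (- s * of_real t)) has_vector_derivative (- s * exp (- s * of_real t))) (at t)"
      by (rule has_vector_derivative_real_field)
    moreover have "((\<lambda>t. complex_of_real (f t)) has_vector_derivative of_real (f' t)) (at t)"
      using der[of t] by (intro has_vector_derivative_of_real)
        (simp add: has_real_derivative_iff_has_vector_derivative)
    ultimately show ?thesis
      unfolding h_def using has_vector_derivative_mult by (fastforce simp: algebra_simps)
  qed
  have "integral {0..T} h = ?E f T - of_real (f 0)" if "T \<ge> 0" for T
    using fundamental_theorem_of_calculus[OF that has_vector_derivative_at_within[OF dh]]
    by (simp add: integral_unique)
  then have ev: "eventually (\<lambda>T. integral {0..T} h = ?E f T - of_real (f 0)) at_top"
    by (rule eventually_mono[OF eventually_ge_at_top[of 0]])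
  have lim1: "((\<lambda>T. integral {0..T} h) \<longlongrightarrow> integral {0..} h) at_top"
  proof -
    have "((\<lambda>T. set_lebesgue_integral lebesgue {0..T} h) \<longlongrightarrow> set_lebesgue_integral lebesgue {0..} h) at_top"
      by (rule tendsto_set_lebesgue_integral_at_top[OF _ hi]) auto
    moreover have "set_lebesgue_integral lebesgue {0..T} h = integral {0..T} h" for T
      by (intro set_lebesgue_integral_eq_integral absolutely_integrable_on_subinterval[OF hi]) auto
    ultimately show ?thesis using set_lebesgue_integral_eq_integral(2)[OF hi] by simp
  qed
  have lim2: "((\<lambda>T. ?E f T - of_real (f 0)) \<longlongrightarrow> 0 - of_real (f 0)) at_top"
  proof (intro tendsto_diff tendsto_const)
    have "((\<lambda>T. C * exp ((\<beta> - Re s) * T)) \<longlongrightarrow> C * 0) at_top"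
      using s by (intro tendsto_mult tendsto_const filterlim_compose[OF exp_at_bot]
        filterlim_tendsto_neg_mult_at_bot[OF tendsto_const] filterlim_ident) auto
    then have "((\<lambda>T. C * exp ((\<beta> - Re s) * T)) \<longlongrightarrow> 0) at_top" by simp
    then show "(?E f \<longlongrightarrow> 0) at_top"
    proof (rule Lim_null_comparison[rotated])
      show "\<forall>\<^sub>F t in at_top. norm (?E f t) \<le> C * exp ((\<beta> - Re s) * t)"
        using eventually_ge_at_top[of 0]
      proof eventually_elim
        case (elim t)
        have "norm (?E f t) = exp (- Re s * t) * \<bar>f t\<bar>" by (simp add: norm_mult)
        also have "\<dots> \<le> exp (- Re s * t) * (C * exp (\<beta> * t))"
          by (intro mult_left_mono f elim) simp
        finally show ?case by (simp add: algebra_simps flip: exp_add)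
      qed
    qed
  qed
  have "integral {0..} h = 0 - of_real (f 0)"
    by (rule tendsto_unique[OF trivial_limit_at_top_linorder lim1 tendsto_cong[OF ev, THEN iffD2, OF lim2]])
  then show ?thesis using hval by (simp add: algebra_simps)
qed

text \<open>Forcing along a fixed vector \<open>b\<close> covers both uses: the state, with
  \<open>g = 0\<close>, and a column of its sensitivity, where \<open>g\<close> is a coordinate of
  the state.\<close>

lemma laplace_linear_ode:
  fixes M :: "real^'n^'n"
  assumes der: "\<And>t. (y has_vector_derivative M *v y t + g t *s b) (at t)"
    and cont: "continuous_on UNIV g"
    and y: "\<And>t. t \<ge> 0 \<Longrightarrow> norm (y t) \<le> C * exp (\<beta> * t)"
    and g: "\<And>t. t \<ge> 0 \<Longrightarrow> \<bar>g t\<bar> \<le> C' * exp (\<beta> * t)" and s: "Re s > \<beta>"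
  shows "(mat s - complex_matrix M) *v (\<chi> i. laplace (\<lambda>t. y t $ i) s)
    = (\<chi> i. of_real (y 0 $ i)) + laplace g s *s (\<chi> i. of_real (b $ i))"
proof -
  have cy: "continuous_on UNIV y"
    using der by (auto intro!: continuous_at_imp_continuous_on has_vector_derivative_continuous)
  have ci: "continuous_on UNIV (\<lambda>t. y t $ i)" for i
    by (intro continuous_intros cy)
  have bi: "\<bar>y t $ i\<bar> \<le> C * exp (\<beta> * t)" if "t \<ge> 0" for t i
    using y[OF that] component_le_norm_cart[of "y t" i] by linarith
  have ai: "(\<lambda>t. exp (- s * of_real t) * of_real (y t $ i)) absolutely_integrable_on {0..}" for i
    by (rule laplace_integrable[OF continuous_on_subset[OF ci] bi s]) auto
  have ag: "(\<lambda>t. exp (- s * of_real t) * of_real (g t)) absolutely_integrable_on {0..}"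
    by (rule laplace_integrable[OF continuous_on_subset[OF cont] g s]) auto
  have *: "s * laplace (\<lambda>t. y t $ i) s - of_real (y 0 $ i)
      = (\<Sum>j\<in>UNIV. of_real (M $ i $ j) * laplace (\<lambda>t. y t $ j) s) + of_real (b $ i) * laplace g s" for i
  proof -
    let ?h = "\<lambda>t. (\<Sum>j\<in>UNIV. M $ i $ j * y t $ j) + b $ i * g t"
    \<comment> \<open>Indexing by \<open>'n option\<close> makes the forcing one more summand, so
      that \<open>laplace_sum\<close> treats the whole right-hand side at once.\<close>
    let ?F = "\<lambda>j t. case j of None \<Rightarrow> g t | Some j \<Rightarrow> y t $ j"
    let ?c = "\<lambda>j. case j of None \<Rightarrow> b $ i | Some j \<Rightarrow> M $ i $ j"
    have aF: "(\<lambda>t. exp (- s * of_real t) * of_real (?F j t)) absolutely_integrable_on {0..}" for j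
      using ai ag by (cases j) auto
    have opt: "(\<Sum>j\<in>UNIV. G j) = G None + (\<Sum>j\<in>UNIV. G (Some j))" for G :: "'n option \<Rightarrow> 'z::comm_monoid_add"
      by (simp add: UNIV_option_conv sum.reindex)
    have "((\<lambda>t. y t $ i) has_real_derivative ?h t) (at t)" for t
      using bounded_linear.has_vector_derivative[OF bounded_linear_vec_nth der[of t], of i]
      by (simp add: has_real_derivative_iff_has_vector_derivative matrix_vector_mult_def mult.commute)
    moreover have "continuous_on UNIV ?h" by (intro continuous_intros ci cont)
    moreover have "\<bar>?h t\<bar> \<le> ((\<Sum>j\<in>UNIV. \<bar>M $ i $ j\<bar> * C) + \<bar>b $ i\<bar> * C') * exp (\<beta> * t)" if "t \<ge> 0" for t
    proof -
      have "\<bar>?h t\<bar> \<le> \<bar>\<Sum>j\<in>UNIV. M $ i $ j * y t $ j\<bar> + \<bar>b $ i * g t\<bar>"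
        by (rule abs_triangle_ineq)
      also have "\<dots> \<le> (\<Sum>j\<in>UNIV. \<bar>M $ i $ j\<bar> * (C * exp (\<beta> * t))) + \<bar>b $ i\<bar> * (C' * exp (\<beta> * t))"
        using bi[OF that] g[OF that]
        by (intro add_mono order_trans[OF sum_abs] sum_mono) (auto simp: abs_mult intro: mult_left_mono)
      finally show ?thesis by (simp add: sum_distrib_left sum_distrib_right algebra_simps)
    qed
    ultimately have "laplace ?h s = s * laplace (\<lambda>t. y t $ i) s - of_real (y 0 $ i)"
      by (intro laplace_derivative[OF _ _ bi _ s])
    moreover have "laplace ?h s = (\<Sum>j\<in>UNIV. of_real (?c j) * laplace (?F j) s)"
      using laplace_sum[of UNIV s ?F ?c, OF aF] by (simp add: opt add.commute[of "b $ i * _"] split: option.split)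
    ultimately show ?thesis by (simp add: opt add.commute)
  qed
  have "(mat s *v v) $ i = s * v $ i" for v :: "complex^'n" and i
    by (simp add: matrix_vector_mult_def mat_def if_distrib[of "\<lambda>x. x * _"] cong: if_cong)
  then show ?thesis
    unfolding vec_eq_iff using * by (simp add: matrix_vector_mult_diff_rdistrib
      matrix_vector_mult_def[of "complex_matrix M"] algebra_simps)
qed

text \<open>An eigenvalue \<open>s\<close> of \<open>M\<close> satisfies |s| \<le> k for any bound
  \<open>k\<close> on the operator norm. This makes \<open>matrix_inv\<close> a genuine inverse on a
  right half plane, which is all that an impulse response is tested on.\<close>

lemma invertible_resolvent:
  fixes M :: "real^'n^'n"
  shows "\<exists>\<sigma>. \<forall>s. Re s > \<sigma> \<longrightarrow> invertible (mat s - complex_matrix M)"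
proof -
  obtain k where k: "k > 0" "\<And>v. norm (complex_matrix M *v v) \<le> norm v * k"
    using bounded_linear.pos_bounded[OF matrix_vector_mul_bounded_linear[of "complex_matrix M"]] by auto
  have "invertible (mat s - complex_matrix M)" if s: "Re s > k" for s
  proof -
    have "v = 0" if "(mat s - complex_matrix M) *v v = 0" for v
    proof (rule ccontr)
      assume "v \<noteq> 0"
      have "(mat s *v v) = s *s v"
        by (simp add: vec_eq_iff matrix_vector_mult_def mat_def if_distrib[of "\<lambda>x. x * _"] cong: if_cong)
      then have "complex_matrix M *v v = s *s v"
        using that by (simp add: matrix_vector_mult_diff_rdistrib)
      then have "cmod s * norm v \<le> norm v * k"
        using k(2)[of v] by (simp add: norm_vec_def norm_mult L2_set_right_distrib)
      then show False using \<open>v \<noteq> 0\<close> s complex_Re_le_cmod[of s] by (simp add: mult.commute)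
    qed
    then show ?thesis
      using matrix_left_invertible_ker invertible_left_inverse by blast
  qed
  then show ?thesis by blast
qed

subsection \<open>Uniqueness of impulse responses\<close>

text \<open>With \<open>u = exp (- t)\<close> the hypothesis says that all polynomial moments on the
  unit interval vanish; Weierstrass approximation extends this to every continuous \<phi>.\<close>

lemma integral_exp_moments_zero:
  fixes f :: "real \<Rightarrow> real"
  assumes ai: "f absolutely_integrable_on {0<..}" and cf: "continuous_on {0<..} f"
    and zero: "\<And>n::nat. integral {0<..} (\<lambda>t. exp (- t) ^ n * f t) = 0"
    and c\<phi>: "continuous_on {0..1} \<phi>"
  shows "(\<lambda>t. \<phi> (exp (- t)) * f t) absolutely_integrable_on {0<..}"
    and "integral {0<..} (\<lambda>t. \<phi> (exp (- t)) * f t) = 0"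
proof -
  have ai_gen: "(\<lambda>t. \<psi> (exp (- t)) * f t) absolutely_integrable_on {0<..}"
    if \<psi>: "continuous_on {0..1} \<psi>" for \<psi> :: "real \<Rightarrow> real"
  proof -
    obtain C where C: "\<And>u. u \<in> {0..1} \<Longrightarrow> norm (\<psi> u) \<le> C"
      using compact_imp_bounded[OF compact_continuous_image[OF \<psi> compact_Icc]]
      unfolding bounded_iff by blast
    show ?thesis
    proof (rule measurable_bounded_by_integrable_imp_absolutely_integrable)
      have "continuous_on {0<..} (\<lambda>t. \<psi> (exp (- t)))"
        by (rule continuous_on_compose2[OF \<psi>]) (auto intro!: continuous_intros)
      then show "(\<lambda>t. \<psi> (exp (- t)) * f t) \<in> borel_measurable (lebesgue_on {0<..})"
        by (intro continuous_imp_measurable_on_sets_lebesgue continuous_intros cf) auto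
      show "(\<lambda>t. C * \<bar>f t\<bar>) integrable_on {0<..}"
        using ai by (intro integrable_on_mult_right) (auto simp: absolutely_integrable_on_def)
      fix t :: real assume "t \<in> {0<..}"
      then show "norm (\<psi> (exp (- t)) * f t) \<le> C * \<bar>f t\<bar>"
        using C[of "exp (- t)"] by (auto simp: abs_mult intro: mult_right_mono)
    qed auto
  qed
  show "(\<lambda>t. \<phi> (exp (- t)) * f t) absolutely_integrable_on {0<..}"
    by (rule ai_gen[OF c\<phi>])
  let ?I = "integral {0<..} (\<lambda>t. \<phi> (exp (- t)) * f t)"
  let ?N = "integral {0<..} (\<lambda>t. \<bar>f t\<bar>)"
  have fi: "(\<lambda>t. \<bar>f t\<bar>) integrable_on {0<..}"
    using ai by (auto simp: absolutely_integrable_on_def)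
  have N0: "?N \<ge> 0" by (intro integral_nonneg fi) auto
  have bound: "\<bar>?I\<bar> \<le> e * ?N" if e: "e > 0" for e
  proof -
    obtain p where p: "real_polynomial_function p" "\<And>u. u \<in> {0..1} \<Longrightarrow> \<bar>\<phi> u - p u\<bar> < e"
      using Stone_Weierstrass_real_polynomial_function[OF compact_Icc c\<phi> e] by blast
    obtain a n where an: "p = (\<lambda>x. \<Sum>i\<le>n. a i * x ^ i)"
      using p(1) real_polynomial_function_iff_sum by auto
    have cp: "continuous_on {0..1} p" unfolding an by (intro continuous_intros)
    have mi: "(\<lambda>t. exp (- t) ^ i * f t) integrable_on {0<..}" for i
      by (intro set_lebesgue_integral_eq_integral ai_gen[of "\<lambda>u. u ^ i"] continuous_intros)
    have "integral {0<..} (\<lambda>t. p (exp (- t)) * f t)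
        = integral {0<..} (\<lambda>t. \<Sum>i\<le>n. a i * (exp (- t) ^ i * f t))"
      unfolding an by (simp add: sum_distrib_right mult.assoc)
    also have "\<dots> = (\<Sum>i\<le>n. integral {0<..} (\<lambda>t. a i * (exp (- t) ^ i * f t)))"
      by (intro integral_sum integrable_on_mult_right mi) auto
    also have "\<dots> = 0"
      by (intro sum.neutral) (auto simp: zero)
    finally have "?I = integral {0<..} (\<lambda>t. \<phi> (exp (- t)) * f t - p (exp (- t)) * f t)"
      by (subst integral_diff) (auto intro!: set_lebesgue_integral_eq_integral ai_gen c\<phi> cp)
    also have "norm \<dots> \<le> integral {0<..} (\<lambda>t. e * \<bar>f t\<bar>)"
    proof (rule integral_norm_bound_integral)
      show "(\<lambda>t. \<phi> (exp (- t)) * f t - p (exp (- t)) * f t) integrable_on {0<..}"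
        by (intro integrable_diff set_lebesgue_integral_eq_integral ai_gen c\<phi> cp)
      show "(\<lambda>t. e * \<bar>f t\<bar>) integrable_on {0<..}"
        by (intro integrable_on_mult_right fi)
      fix t :: real assume "t \<in> {0<..}"
      then have "\<bar>\<phi> (exp (- t)) - p (exp (- t))\<bar> \<le> e" using p(2)[of "exp (- t)"] by simp
      then show "norm (\<phi> (exp (- t)) * f t - p (exp (- t)) * f t) \<le> e * \<bar>f t\<bar>"
        by (simp add: abs_mult mult_right_mono flip: left_diff_distrib)
    qed
    finally show ?thesis by simp
  qed
  show "?I = 0"
  proof (rule ccontr)
    assume I: "?I \<noteq> 0"
    \<comment> \<open>The choice \<open>e = \<bar>?I\<bar> / (?N + 1)\<close> contradicts
      \<open>?N < ?N + 1\<close>; the summand 1 also covers \<open>?N = 0\<close>.\<close>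
    then have "\<bar>?I\<bar> \<le> \<bar>?I\<bar> / (?N + 1) * ?N"
      using N0 by (intro bound) simp
    then have "\<bar>?I\<bar> * (?N + 1) \<le> \<bar>?I\<bar> * ?N"
      using N0 by (simp add: field_simps)
    then show False using I N0 by (simp add: algebra_simps)
  qed
qed

text \<open>Sampling the transform at \<open>\<sigma> + 1 + n\<close> gives the moments of
  \<open>f\<close> with an exponential weight. If \<open>f a\<close> were nonzero, testing against a
  bump around \<open>a\<close> would give a nonnegative function with integral 0 that is positive at
  \<open>a\<close>.\<close>

lemma lerch:
  fixes f :: "real \<Rightarrow> real"
  assumes cf: "continuous_on {0<..} f"
    and ai: "\<And>s. s > \<sigma> \<Longrightarrow> (\<lambda>t. exp (- s * t) * f t) absolutely_integrable_on {0..}"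
    and zero: "\<And>s. s > \<sigma> \<Longrightarrow> integral {0..} (\<lambda>t. exp (- s * t) * f t) = 0"
    and a: "a > 0"
  shows "f a = 0"
proof (rule ccontr)
  assume "f a \<noteq> 0"
  \<comment> \<open>The weight makes \<open>g\<close> integrable and places every sampling point
    beyond \<sigma>; the sign makes \<open>g a\<close> positive.\<close>
  define g where "g t = sgn (f a) * (exp (- (\<sigma> + 1) * t) * f t)" for t
  have cg: "continuous_on {0<..} g" unfolding g_def by (intro continuous_intros cf)
  have ga: "g a > 0" using \<open>f a \<noteq> 0\<close> by (simp add: g_def sgn_if mult_less_0_iff)
  have aig: "g absolutely_integrable_on {0<..}"
    unfolding g_def using ai[of "\<sigma> + 1"]
    by (intro set_integrable_mult_right)
      (simp add: absolutely_integrable_spike_set_eq[OF negligible_half_line_diff])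
  have zg: "integral {0<..} (\<lambda>t. exp (- t) ^ n * g t) = 0" for n :: nat
  proof -
    have "exp (- t) ^ n * g t = sgn (f a) * (exp (- (\<sigma> + 1 + real n) * t) * f t)" for t
      by (simp add: g_def algebra_simps exp_add exp_diff exp_minus exp_of_nat_mult exp_of_nat2_mult divide_simps power_inverse)
    then show ?thesis
      using zero[of "\<sigma> + 1 + real n"]
      by (simp add: integral_spike_set[OF negligible_half_line_diff] del: minus_add_distrib)
  qed
  have "isCont (\<lambda>u. g (- ln u)) (exp (- a))"
  proof (rule continuous_at_compose[of _ _ g, unfolded o_def])
    have "isCont g a" using cg a by (simp add: continuous_on_eq_continuous_at)
    then show "isCont g (- ln (exp (- a)))" by simp
    show "isCont (\<lambda>u. - ln u) (exp (- a))" by (intro continuous_intros) auto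
  qed
  then obtain d where d: "d > 0" "\<And>u. \<bar>u - exp (- a)\<bar> < d \<Longrightarrow> \<bar>g (- ln u) - g a\<bar> < g a"
    using ga unfolding continuous_at_eps_delta by (force simp: dist_real_def)
  \<comment> \<open>A tent in the variable \<open>u = exp (- t)\<close>, supported where
    \<open>g\<close> is known to be positive, so that its product with \<open>g\<close> is
    nonnegative everywhere.\<close>
  define \<phi> where "\<phi> u = max 0 (d - \<bar>u - exp (- a)\<bar>)" for u :: real
  have c\<phi>: "continuous_on A \<phi>" for A unfolding \<phi>_def by (intro continuous_intros)
  let ?h = "\<lambda>t. \<phi> (exp (- t)) * g t"
  have h0: "?h t \<ge> 0" for t
    using d(2)[of "exp (- t)"] by (cases "\<bar>exp (- t) - exp (- a)\<bar> < d") (auto simp: \<phi>_def)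
  have hi: "?h integrable_on {0<..}" and hz: "integral {0<..} ?h = 0"
    using integral_exp_moments_zero[OF aig cg zg c\<phi>] by (auto intro: set_lebesgue_integral_eq_integral)
  \<comment> \<open>Vanishing at a point is concluded on a compact interval on which the integrand
    is continuous; \<open>{a/2..a}\<close> stays away from 0 and contains \<open>a\<close>.\<close>
  have hi': "?h integrable_on {a/2..a}"
    using integral_exp_moments_zero(1)[OF aig cg zg c\<phi>]
    by (intro set_lebesgue_integral_eq_integral absolutely_integrable_on_subinterval[where S = "{0<..}"])
      (use a in auto)
  have ch: "continuous_on {a/2..a} ?h"
    using a by (intro continuous_intros continuous_on_compose2[OF c\<phi>[of UNIV]] continuous_on_subset[OF cg]) auto
  have "integral {a/2..a} ?h \<le> integral {0<..} ?h"
    using a by (intro integral_subset_le hi hi') (auto intro: h0)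
  moreover have "integral {a/2..a} ?h \<ge> 0" by (intro integral_nonneg hi' h0)
  ultimately have "integral {a/2..a} ?h = 0" using hz by simp
  then have "?h a = 0"
    using has_integral_0_cbox_imp_0[of "a/2" a ?h a] ch h0 integrable_integral[OF hi'] a by auto
  then show False using ga d(1) by (simp add: \<phi>_def)
qed

lemma impulse_response_eqI:
  fixes h :: "real \<Rightarrow> real^'m^'n"
  assumes "is_impulse_response H h"
  shows "impulse_response H = h"
  unfolding impulse_response_def
proof (rule the_equality[where P = "is_impulse_response H", OF assms])
  fix g assume g: "is_impulse_response H g"
  let ?E = "\<lambda>s t. exp (- s * complex_of_real t)"
  obtain \<sigma>\<^sub>g where G: "\<And>s i j. Re s > \<sigma>\<^sub>g \<Longrightarrow>
      (\<lambda>t. ?E s t * of_real (g t $ i $ j)) absolutely_integrable_on {0..} \<and>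
      integral {0..} (\<lambda>t. ?E s t * of_real (g t $ i $ j)) = H s $ i $ j"
    using g unfolding is_impulse_response_def by blast
  obtain \<sigma>\<^sub>h where H: "\<And>s i j. Re s > \<sigma>\<^sub>h \<Longrightarrow>
      (\<lambda>t. ?E s t * of_real (h t $ i $ j)) absolutely_integrable_on {0..} \<and>
      integral {0..} (\<lambda>t. ?E s t * of_real (h t $ i $ j)) = H s $ i $ j"
    using assms unfolding is_impulse_response_def by blast
  have "g t $ i $ j - h t $ i $ j = 0" if "t > 0" for t i j
  proof (rule lerch[where f = "\<lambda>t. g t $ i $ j - h t $ i $ j" and \<sigma> = "max \<sigma>\<^sub>g \<sigma>\<^sub>h", OF _ _ _ that])
    show "continuous_on {0<..} (\<lambda>t. g t $ i $ j - h t $ i $ j)"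
      using g assms unfolding is_impulse_response_def by (intro continuous_intros) auto
    fix s assume s: "s > max \<sigma>\<^sub>g \<sigma>\<^sub>h"
    \<comment> \<open>\<open>lerch\<close> speaks of real exponents and real functions, so the
      complex integrands are taken at real \<open>s\<close> and reduced to their real parts.\<close>
    let ?f = "\<lambda>t. ?E (of_real s) t * of_real (g t $ i $ j) - ?E (of_real s) t * of_real (h t $ i $ j)"
    have ai: "?f absolutely_integrable_on {0..}"
      using G[of "of_real s" i j] H[of "of_real s" i j] s by (intro set_integral_diff) auto
    have I: "integral {0..} ?f = 0"
      using G[of "of_real s" i j] H[of "of_real s" i j] s
      by (subst integral_diff) (auto intro: set_lebesgue_integral_eq_integral)
    have Re: "Re (?f t) = exp (- s * t) * (g t $ i $ j - h t $ i $ j)" for t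
    proof -
      have "?E (of_real s) t = of_real (exp (- s * t))" by (simp flip: exp_of_real)
      then show ?thesis by (simp add: algebra_simps)
    qed
    show "(\<lambda>t. exp (- s * t) * (g t $ i $ j - h t $ i $ j)) absolutely_integrable_on {0..}"
      using absolutely_integrable_linear[OF ai bounded_linear_Re] by (simp only: o_def Re)
    show "integral {0..} (\<lambda>t. exp (- s * t) * (g t $ i $ j - h t $ i $ j)) = 0"
      using integral_linear[OF set_lebesgue_integral_eq_integral(1)[OF ai] bounded_linear_Re] I
      by (simp only: o_def Re zero_complex.simps)
  qed
  moreover have "g t = h t" if "t \<le> 0" for t
    using that g assms by (simp add: is_impulse_response_def)
  ultimately show "g = h"
    by (intro ext) (metis eq_iff_diff_eq_0 linorder_not_less vec_eq_iff)
qed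

subsection \<open>Exponential decay under bounded forcing\<close>

text \<open>This is p(M) v, evaluated by the Horner scheme directly on the vector.\<close>

definition poly_mv :: "complex poly \<Rightarrow> complex^'n^'n \<Rightarrow> complex^'n \<Rightarrow> complex^'n"
  where "poly_mv p M v = fold_coeffs (\<lambda>a w. a *s v + M *v w) p 0"

lemma poly_mv_0 [simp]: "poly_mv 0 M v = 0"
  by (simp add: poly_mv_def)

lemma poly_mv_pCons [simp]: "poly_mv (pCons a p) M v = a *s v + M *v poly_mv p M v"
  by (cases "p = 0 \<and> a = 0") (auto simp: poly_mv_def)

lemma poly_mv_add: "poly_mv (p + q) M v = poly_mv p M v + poly_mv q M v"
  by (induction p q rule: poly_induct2) (simp_all add: algebra_simps matrix_vector_right_distrib vec.scale_left_distrib)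

lemma poly_mv_smult: "poly_mv (smult c p) M v = c *s poly_mv p M v"
  by (induction p) (simp_all add: vector_add_ldistrib vec.scale)

lemma poly_mv_monom: "poly_mv (monom c i) M v = c *s (((*v) M ^^ i) v)"
  by (induction i) (simp_all add: monom_0 monom_Suc vec.scale)

lemma poly_mv_sum: "poly_mv (\<Sum>i\<in>I. p i) M v = (\<Sum>i\<in>I. poly_mv (p i) M v)"
  by (induction I rule: infinite_finite_induct) (simp_all add: poly_mv_add)

lemma poly_mv_linear_factor:
  "poly_mv ([:- l, 1:] * q) M v = M *v poly_mv q M v - l *s poly_mv q M v"
proof -
  have *: "[:- l, 1:] * q = smult (- l) q + pCons 0 q" by simp
  show ?thesis unfolding * poly_mv_add poly_mv_smult by simp
qed

text \<open>Because q(M) commutes with \<open>M - l\<close>, a vector \<open>y\<close> killed by (X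
  - l) q yields a vector \<open>M y - l y\<close> killed by \<open>q\<close>. The decay induction
  descends in this way.\<close>

lemma poly_mv_commute:
  "poly_mv q M (M *v v - l *s v) = M *v poly_mv q M v - l *s poly_mv q M v"
proof (induction q)
  case (pCons a q)
  show ?case
    by (simp add: pCons.IH vec.scale matrix_vector_right_distrib matrix_vector_mult_diff_distrib
        vec.scale_right_distrib vec.scale_right_diff_distrib)
qed simp

text \<open>There is one more index than the dimension. Dependence is a property of sets and does
  not see repetitions, so the case of two equal terms gets its own relation, their
  difference.\<close>

lemma linear_relation_sequence:
  fixes f :: "nat \<Rightarrow> 'a::euclidean_space"
  shows "\<exists>c. (\<exists>i\<le>DIM('a). c i \<noteq> 0) \<and> (\<Sum>i\<le>DIM('a). c i *\<^sub>R f i) = 0"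
proof (cases "inj_on f {..DIM('a)}")
  case True
  then have "dependent (f ` {..DIM('a)})"
    by (intro dependent_biggerset) (simp add: card_image)
  then obtain u where u: "\<exists>v\<in>f ` {..DIM('a)}. u v \<noteq> 0" "(\<Sum>v\<in>f ` {..DIM('a)}. u v *\<^sub>R v) = 0"
    by (auto simp: real_vector.dependent_finite)
  then show ?thesis
    using True by (intro exI[of _ "u \<circ> f"]) (auto simp: sum.reindex)
next
  case False
  then obtain i j where ij: "i \<le> DIM('a)" "j \<le> DIM('a)" "i \<noteq> j" "f i = f j"
    by (auto simp: inj_on_def)
  let ?c = "\<lambda>k. (if k = i then 1 else 0) - (if k = j then 1 else 0) :: real"
  have "(\<Sum>k\<le>DIM('a). ?c k *\<^sub>R f k) = 0"
    using ij by (simp add: scaleR_left_diff_distrib sum_subtractf if_distrib[of "\<lambda>x. x *\<^sub>R _"] cong: if_cong)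
  moreover have "?c i \<noteq> 0" using ij by simp
  ultimately show ?thesis using ij(1) by (intro exI[of _ ?c]) blast
qed

lemma annihilating_polynomial:
  fixes M :: "complex^'n^'n"
  shows "\<exists>p. p \<noteq> 0 \<and> (\<forall>v. poly_mv p M v = 0)"
proof -
  define P where "P i = ((**) M ^^ i) (mat 1)" for i
  have P: "P i *v v = ((*v) M ^^ i) v" for i v
    by (induction i) (simp_all add: P_def flip: matrix_vector_mul_assoc)
  \<comment> \<open>The dimension over the reals, so the relation among the powers of
    \<open>M\<close> has real coefficients, which are then embedded into the complex
    numbers.\<close>
  let ?D = "DIM(complex^'n^'n)"
  obtain c where c: "\<exists>i\<le>?D. c i \<noteq> 0" "(\<Sum>i\<le>?D. c i *\<^sub>R P i) = 0"
    using linear_relation_sequence[of P] by blast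
  define p where "p = (\<Sum>i\<le>?D. monom (complex_of_real (c i)) i)"
  have "coeff p i = (if i \<le> ?D then of_real (c i) else 0)" for i
    by (simp add: p_def coeff_sum)
  then have "p \<noteq> 0" using c(1) by (metis coeff_0 of_real_eq_0_iff)
  moreover have "poly_mv p M v = 0" for v
  proof -
    have "poly_mv p M v = (\<Sum>i\<le>?D. of_real (c i) *s (P i *v v))"
      by (simp add: p_def poly_mv_sum poly_mv_monom P)
    also have "\<dots> = (\<Sum>i\<le>?D. (c i *\<^sub>R P i) *v v)"
      by (intro sum.cong) (auto simp: vec_eq_iff matrix_vector_mult_def sum_distrib_left scaleR_conv_of_real[where 'a=complex] mult.assoc)
    also have "\<dots> = (\<Sum>i\<le>?D. c i *\<^sub>R P i) *v v"
      unfolding matrix_vector_mult_def vec_eq_iff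
      by (simp add: sum_component sum_distrib_right) (intro allI sum.swap)
    finally show ?thesis using c(2) by simp
  qed
  ultimately show ?thesis by blast
qed

text \<open>Take an annihilating polynomial of least degree. If \<open>p = (X - l) q\<close>, then
  \<open>q\<close> does not annihilate by minimality, and any nonzero q(M) v is an eigenvector for
  \<open>l\<close>. This lets \<open>hurwitz\<close>, a condition on eigenvalues, control the
  roots.\<close>

lemma annihilating_polynomial_eigenvalues:
  fixes M :: "complex^'n^'n"
  shows "\<exists>p. p \<noteq> 0 \<and> (\<forall>v. poly_mv p M v = 0) \<and>
    (\<forall>l. poly p l = 0 \<longrightarrow> (\<exists>v. v \<noteq> 0 \<and> M *v v = l *s v))"
proof -
  let ?ann = "\<lambda>p. p \<noteq> 0 \<and> (\<forall>v. poly_mv p M v = 0)"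
  obtain p where p: "?ann p" "\<And>q. ?ann q \<Longrightarrow> degree p \<le> degree q"
    using annihilating_polynomial[of M] ex_has_least_nat[of ?ann _ degree] by metis
  have "\<exists>v. v \<noteq> 0 \<and> M *v v = l *s v" if "poly p l = 0" for l
  proof -
    from that obtain q where q: "p = [:- l, 1:] * q" by (auto simp: poly_eq_0_iff_dvd)
    with p(1) have "q \<noteq> 0" by auto
    then have "degree q < degree p" unfolding q by (subst degree_mult_eq) auto
    then obtain v where "poly_mv q M v \<noteq> 0" using p(2)[of q] \<open>q \<noteq> 0\<close> by auto
    moreover have "M *v poly_mv q M v = l *s poly_mv q M v"
      using p(1) poly_mv_linear_factor[of l q M v] by (simp add: q del: mult_pCons_left)
    ultimately show ?thesis by blast
  qed
  with p(1) show ?thesis by blast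
qed

section \<open>Decay estimates, one root at a time\<close>

lemma norm_vector_scalar_mult: "norm (c *s v) = cmod c * norm v" for v :: "complex^'n"
  by (simp add: norm_vec_def norm_mult L2_set_right_distrib)

lemma bounded_bilinear_vector_scalar_mult:
  "bounded_bilinear (\<lambda>c v. c *s v :: complex^'n)"
  by (unfold_locales) (auto simp: vec.scale_left_distrib vec.scale_right_distrib vec_eq_iff
      norm_vector_scalar_mult intro!: exI[of _ 1])

text \<open>Variation of constants, in the form of a bound on the derivative of \<open>exp (- l t) y t\<close>.\<close>

lemma scalar_forced_bound:
  fixes y :: "real \<Rightarrow> complex^'n"
  assumes der: "\<And>t. (y has_vector_derivative l *s y t + w t) (at t)"
    and w: "\<And>t. t \<in> {0..T} \<Longrightarrow> norm (w t) \<le> c * exp (- a * t)"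
    and l: "Re l < - a" and t: "t \<in> {0..T}"
  shows "norm (y t) \<le> (norm (y 0) + c / (- Re l - a)) * exp (- a * t)"
proof -
  \<comment> \<open>\<gamma> is the gap between \<open>Re l\<close> and the rate \<open>- a\<close>.
    The derivative of \<open>z\<close> is bounded by \<open>c * exp (\<gamma> * t)\<close>, and
    integrating this produces the constant \<open>c / \<gamma>\<close>.\<close>
  define \<gamma> where "\<gamma> = - Re l - a"
  have \<gamma>: "\<gamma> > 0" using l by (simp add: \<gamma>_def)
  have c: "c \<ge> 0"
    using order_trans[OF norm_ge_zero w[of 0]] t by simp
  define z where "z t = exp (- l * of_real t) *s y t" for t
  have dz: "(z has_vector_derivative exp (- l * of_real t) *s w t) (at t)" for t
  proof -
    have "((\<lambda>z. exp (- l * z)) has_field_derivative (- l * exp (- l * of_real t))) (at (of_real t))"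
      by (auto intro!: derivative_eq_intros)
    then have "((\<lambda>t. exp (- l * of_real t)) has_vector_derivative (- l * exp (- l * of_real t))) (at t)"
      by (rule has_vector_derivative_real_field)
    from bounded_bilinear.has_vector_derivative[OF bounded_bilinear_vector_scalar_mult this der[of t]]
    show ?thesis unfolding z_def
      by (rule has_vector_derivative_eq_rhs) (simp add: vec_eq_iff algebra_simps)
  qed
  have "norm (z t - z 0) \<le> c / \<gamma> * exp (\<gamma> * t) - c / \<gamma> * exp (\<gamma> * 0)"
  \<comment> \<open>The mean value bound needs an interval of positive length.\<close>
  proof (cases "t = 0")
    case False
    show ?thesis
    proof (rule differentiable_bound_general)
      show "0 < t" using False t by auto
      show "continuous_on {0..t} z"
        using dz by (auto intro!: continuous_at_imp_continuous_on has_vector_derivative_continuous)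
      show "continuous_on {0..t} (\<lambda>t. c / \<gamma> * exp (\<gamma> * t))" by (intro continuous_intros)
      show "(z has_vector_derivative exp (- l * of_real s) *s w s) (at s)" for s by (rule dz)
      show "((\<lambda>t. c / \<gamma> * exp (\<gamma> * t)) has_vector_derivative c * exp (\<gamma> * s)) (at s)" for s
        unfolding has_real_derivative_iff_has_vector_derivative[symmetric]
        using \<gamma> by (auto intro!: derivative_eq_intros)
      fix s assume s: "0 < s" "s < t"
      have "norm (exp (- l * of_real s) *s w s) = exp (- Re l * s) * norm (w s)"
        by (simp add: norm_vector_scalar_mult)
      also have "\<dots> \<le> exp (- Re l * s) * (c * exp (- a * s))"
        using s t by (intro mult_left_mono w) auto
      also have "\<dots> = c * exp (\<gamma> * s)" by (simp add: \<gamma>_def algebra_simps flip: exp_add)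
      finally show "norm (exp (- l * of_real s) *s w s) \<le> c * exp (\<gamma> * s)" .
    qed
  qed simp
  also have "\<dots> \<le> c / \<gamma> * exp (\<gamma> * t)" using c \<gamma> by simp
  finally have "norm (z t) \<le> norm (y 0) + c / \<gamma> * exp (\<gamma> * t)"
    using norm_triangle_sub[of "z t" "z 0"] by (simp add: z_def)
  moreover have "norm (y t) = exp (Re l * t) * norm (z t)"
    by (simp add: z_def norm_vector_scalar_mult flip: exp_add mult.assoc)
  ultimately have "norm (y t) \<le> exp (Re l * t) * (norm (y 0) + c / \<gamma> * exp (\<gamma> * t))"
    by (simp add: mult_left_mono)
  also have "\<dots> = exp (Re l * t) * norm (y 0) + c / \<gamma> * exp (- a * t)"
    by (simp add: \<gamma>_def algebra_simps flip: exp_add)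
  also have "\<dots> \<le> exp (- a * t) * norm (y 0) + c / \<gamma> * exp (- a * t)"
    using l t mult_right_mono[of "Re l" "-a" t] by (intro add_mono mult_right_mono) auto
  finally show ?thesis by (simp add: \<gamma>_def algebra_simps)
qed

text \<open>Induction on the degree: with \<open>p = (X - l) q\<close>, the function
  \<open>M y - l y\<close> is killed by \<open>q\<close> and solves the same equation with modified
  forcing, so it decays; then \<open>y\<close> solves a scalar equation with decaying forcing.
  Annihilation is required along \<open>y\<close> only, since \<open>q\<close> need not annihilate
  other vectors. The strict inequality \<open>Re l < - a\<close> keeps the same rate at every step,
  so multiple roots produce no powers of \<open>t\<close>.\<close>

lemma annihilated_forced_bound:
  fixes M :: "complex^'n^'n"
  assumes "p \<noteq> 0" "\<And>l. poly p l = 0 \<Longrightarrow> Re l < - a"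
  shows "\<exists>C\<ge>0. \<forall>y g T c. (\<forall>t. (y has_vector_derivative M *v y t + g t) (at t)) \<longrightarrow>
      (\<forall>t. poly_mv p M (y t) = 0) \<longrightarrow> (\<forall>t\<in>{0..T}. norm (g t) \<le> c * exp (- a * t)) \<longrightarrow>
      (\<forall>t\<in>{0..T}. norm (y t) \<le> C * (norm (y 0) + c) * exp (- a * t))"
  using assms
proof (induction "degree p" arbitrary: p)
  case 0
  then obtain k where k: "p = [:k:]" "k \<noteq> 0" by (metis degree_eq_zeroE pCons_eq_0_iff)
  then have "poly_mv p M v = 0 \<longleftrightarrow> v = 0" for v by (simp add: vec_eq_iff)
  then show ?case by (intro exI[of _ 0]) simp
next
  case (Suc n)
  have "\<not> constant (poly p)" using Suc.hyps(2) by (simp add: constant_degree)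
  then obtain l where l: "poly p l = 0" using fundamental_theorem_of_algebra by blast
  then obtain q where q: "p = [:- l, 1:] * q" by (auto simp: poly_eq_0_iff_dvd)
  have "q \<noteq> 0" using q Suc.prems by auto
  then have "n = degree q" using Suc.hyps(2) unfolding q by (subst (asm) degree_mult_eq) auto
  moreover have "Re r < - a" if "poly q r = 0" for r
    using that Suc.prems(2)[of r] by (simp add: q del: mult_pCons_left)
  ultimately obtain C where C: "C \<ge> 0" and bd: "\<And>y g T c t.
      (\<And>t. (y has_vector_derivative M *v y t + g t) (at t)) \<Longrightarrow> (\<And>t. poly_mv q M (y t) = 0) \<Longrightarrow>
      (\<And>t. t \<in> {0..T} \<Longrightarrow> norm (g t) \<le> c * exp (- a * t)) \<Longrightarrow> t \<in> {0..T} \<Longrightarrow>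
      norm (y t) \<le> C * (norm (y 0) + c) * exp (- a * t)"
    using Suc.hyps(1)[OF _ \<open>q \<noteq> 0\<close>] by metis
  define N where "N v = M *v v - l *s v" for v :: "complex^'n"
  have bl: "bounded_linear N" unfolding N_def
    by (intro bounded_linear_sub matrix_vector_mul_bounded_linear
        bounded_bilinear.bounded_linear_right[OF bounded_bilinear_vector_scalar_mult])
  obtain k where k: "k > 0" "\<And>v. norm (N v) \<le> norm v * k"
    using bounded_linear.pos_bounded[OF bl] by auto
  define \<gamma> where "\<gamma> = - Re l - a"
  have la: "Re l < - a" by (rule Suc.prems(2)[OF l])
  then have \<gamma>: "\<gamma> > 0" by (simp add: \<gamma>_def)
  \<comment> \<open>From \<open>norm (y 0) \<le> s\<close> and \<open>c \<le> s\<close>, where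
    \<open>s = norm (y 0) + c\<close>, in the scalar bound with forcing constant
    \<open>C * k * s + c\<close>.\<close>
  define C' where "C' = 1 + (C * k + 1) / \<gamma>"
  have "norm (y t) \<le> C' * (norm (y 0) + c) * exp (- a * t)"
    if der: "\<And>t. (y has_vector_derivative M *v y t + g t) (at t)"
      and ann: "\<And>t. poly_mv p M (y t) = 0"
      and g: "\<And>t. t \<in> {0..T} \<Longrightarrow> norm (g t) \<le> c * exp (- a * t)" and t: "t \<in> {0..T}" for y g T c t
  proof -
    have c: "c \<ge> 0" using order_trans[OF norm_ge_zero g[of 0]] t by simp
    have w: "norm (N (y t)) \<le> C * (norm (N (y 0)) + k * c) * exp (- a * t)" if "t \<in> {0..T}" for t
    proof (rule bd[OF _ _ _ that])
      show "((\<lambda>t. N (y t)) has_vector_derivative M *v N (y t) + N (g t)) (at t)" for t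
        using bounded_linear.has_vector_derivative[OF bl der[of t]]
        by (rule has_vector_derivative_eq_rhs)
          (simp add: N_def matrix_vector_right_distrib matrix_vector_mult_diff_distrib
             vec.scale vec.scale_right_distrib)
      show "poly_mv q M (N (y t)) = 0" for t
        using ann[of t] by (simp add: N_def q poly_mv_commute poly_mv_linear_factor del: mult_pCons_left)
      show "norm (N (g t)) \<le> k * c * exp (- a * t)" if "t \<in> {0..T}" for t
        using order_trans[OF k(2)[of "g t"] mult_right_mono[OF g[OF that], of k]] k(1) by (simp add: mult_ac)
    qed
    let ?s = "norm (y 0) + c"
    have "norm (y t) \<le> (norm (y 0) + (C * k * ?s + c) / (- Re l - a)) * exp (- a * t)"
    proof (rule scalar_forced_bound[OF _ _ la t])
      show "(y has_vector_derivative l *s y t + (N (y t) + g t)) (at t)" for t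
        using der[of t] by (simp add: N_def)
      fix t assume t: "t \<in> {0..T}"
      have "norm (N (y t) + g t) \<le> C * (norm (N (y 0)) + k * c) * exp (- a * t) + c * exp (- a * t)"
        by (rule norm_triangle_mono[OF w[OF t] g[OF t]])
      also have "\<dots> \<le> C * (norm (y 0) * k + k * c) * exp (- a * t) + c * exp (- a * t)"
        using k(2)[of "y 0"] C c by (intro add_mono mult_right_mono mult_left_mono) auto
      finally show "norm (N (y t) + g t) \<le> (C * k * ?s + c) * exp (- a * t)"
        by (simp add: algebra_simps)
    qed
    also have "\<dots> \<le> C' * ?s * exp (- a * t)"
    proof (rule mult_right_mono)
      have "norm (y 0) + (C * k * ?s + c) / \<gamma> \<le> ?s + (C * k * ?s + ?s) / \<gamma>"
        using c \<gamma> by (intro add_mono divide_right_mono) auto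
      also have "\<dots> = C' * ?s" by (simp add: C'_def algebra_simps add_divide_distrib)
      finally show "norm (y 0) + (C * k * ?s + c) / (- Re l - a) \<le> C' * ?s" by (simp add: \<gamma>_def)
    qed simp
    finally show ?thesis .
  qed
  moreover have "C' \<ge> 0" using C k(1) \<gamma> by (simp add: C'_def)
  ultimately show ?case by (intro exI[of _ C']) blast
qed

text \<open>The constants depend on \<open>M\<close> alone, and the forcing is controlled only up to
  \<open>T\<close>. Both matter when the forcing contains the unknown solution itself.\<close>

lemma hurwitz_forced_bound:
  fixes M :: "real^'n^'n"
  assumes "hurwitz M"
  obtains C a where "C > 0" "a > 0" "\<And>y g T c t.
      (\<And>t. (y has_vector_derivative M *v y t + g t) (at t)) \<Longrightarrow>
      (\<And>t. t \<in> {0..T} \<Longrightarrow> norm (g t) \<le> c * exp (- a * t)) \<Longrightarrow> t \<in> {0..T} \<Longrightarrow>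
      norm (y t) \<le> C * (norm (y 0) + c) * exp (- a * t)"
proof -
  let ?M = "complex_matrix M"
  obtain p where p: "p \<noteq> 0" "\<And>v. poly_mv p ?M v = 0"
      "\<And>l. poly p l = 0 \<Longrightarrow> \<exists>v. v \<noteq> 0 \<and> ?M *v v = l *s v"
    using annihilating_polynomial_eigenvalues[of ?M] by blast
  \<comment> \<open>The inserted \<open>- 1\<close> makes the set visibly nonempty, as
    \<open>Max\<close> requires.\<close>
  let ?S = "insert (- 1) (Re ` {l. poly p l = 0})"
  have fin: "finite ?S" using poly_roots_finite[OF p(1)] by simp
  have "Max ?S < 0"
    using p(3) assms unfolding hurwitz_def by (subst Max_less_iff[OF fin]) auto
  \<comment> \<open>Halving leaves the strict margin \<open>Re l < - a\<close> at every
    root.\<close>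
  define a where "a = - Max ?S / 2"
  have a: "a > 0" using \<open>Max ?S < 0\<close> by (simp add: a_def)
  have "Re l < - a" if "poly p l = 0" for l
  proof -
    have "Re l \<le> Max ?S" using that by (intro Max_ge[OF fin]) auto
    then show ?thesis using \<open>Max ?S < 0\<close> by (simp add: a_def)
  qed
  then obtain C where C: "C \<ge> 0" and bd: "\<And>y g T c t.
      (\<And>t. (y has_vector_derivative ?M *v y t + g t) (at t)) \<Longrightarrow>
      (\<And>t. t \<in> {0..T} \<Longrightarrow> norm (g t) \<le> c * exp (- a * t)) \<Longrightarrow> t \<in> {0..T} \<Longrightarrow>
      norm (y t) \<le> C * (norm (y 0) + c) * exp (- a * t)"
    using annihilated_forced_bound[OF p(1), of a ?M] p(2) by metis
  \<comment> \<open>The embedding into complex vectors is isometric and intertwines the two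
    matrices, so the complex estimate returns unchanged.\<close>
  define cv where "cv v = (\<chi> i. complex_of_real (v $ i))" for v :: "real^'n"
  have ncv: "norm (cv v) = norm v" for v by (simp add: cv_def norm_vec_def)
  have blcv: "bounded_linear cv"
    by (rule bounded_linear_intro[of _ 1]) (auto simp: ncv, auto simp: cv_def vec_eq_iff scaleR_conv_of_real[where 'a=complex])
  have cvM: "cv (M *v v) = ?M *v cv v" for v
    by (simp add: cv_def vec_eq_iff matrix_vector_mult_def)
  show thesis
  proof (rule that[of "C + 1" a])
    fix y g T c t
    assume der: "\<And>t. (y has_vector_derivative M *v y t + g t) (at t)"
      and g: "\<And>t. t \<in> {0..T} \<Longrightarrow> norm (g t) \<le> c * exp (- a * t)" and t: "t \<in> {0..T}"
    have c: "c \<ge> 0" using order_trans[OF norm_ge_zero g[of 0]] t by simp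
    have "norm (cv (y t)) \<le> C * (norm (cv (y 0)) + c) * exp (- a * t)"
    proof (rule bd[OF _ _ t])
      show "((\<lambda>t. cv (y t)) has_vector_derivative ?M *v cv (y t) + cv (g t)) (at t)" for t
        using bounded_linear.has_vector_derivative[OF blcv der[of t]]
        by (simp add: linear_add[OF bounded_linear.linear[OF blcv]] cvM)
      show "norm (cv (g t)) \<le> c * exp (- a * t)" if "t \<in> {0..T}" for t
        using g[OF that] by (simp add: ncv)
    qed
    also have "\<dots> \<le> (C + 1) * (norm (cv (y 0)) + c) * exp (- a * t)"
      using c by (intro mult_right_mono) auto
    finally show "norm (y t) \<le> (C + 1) * (norm (y 0) + c) * exp (- a * t)"
      by (simp add: ncv)
  qed (use C a in auto)
qed

subsection \<open>The state and its sensitivity\<close>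

text \<open>Cutting \<open>f\<close> off at time 0 changes the integrand on the half line at a
  single point, so the transform of the smooth solution is that of the causal signal.\<close>

lemma impulse_response_columnvector:
  fixes f :: "real \<Rightarrow> real^'n" and H :: "complex \<Rightarrow> complex^1^'n"
  assumes cont: "continuous_on UNIV f"
    and bound: "\<And>t. t \<ge> 0 \<Longrightarrow> norm (f t) \<le> C * exp (\<beta> * t)"
    and H: "\<And>s i. Re s > \<sigma> \<Longrightarrow> laplace (\<lambda>t. f t $ i) s = H s $ i $ 1"
  shows "impulse_response H = (\<lambda>t. if t \<le> 0 then 0 else columnvector (f t))"
proof (rule impulse_response_eqI)
  let ?h = "\<lambda>t. if t \<le> 0 then 0 else columnvector (f t) :: real^1^'n"
  let ?E = "\<lambda>s t. exp (- s * complex_of_real t)"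
  have "(\<lambda>t. ?E s t * of_real (?h t $ i $ j)) absolutely_integrable_on {0..} \<and>
        integral {0..} (\<lambda>t. ?E s t * of_real (?h t $ i $ j)) = H s $ i $ j"
    if s: "Re s > max \<sigma> \<beta>" for s i and j :: 1
  proof -
    have ai: "(\<lambda>t. ?E s t * of_real (f t $ i)) absolutely_integrable_on {0..}"
    proof (rule laplace_integrable)
      show "continuous_on {0<..} (\<lambda>t. f t $ i)"
        by (intro continuous_intros continuous_on_subset[OF cont]) auto
      show "\<bar>f t $ i\<bar> \<le> C * exp (\<beta> * t)" if "t > 0" for t
        using bound[of t] component_le_norm_cart[of "f t" i] that by linarith
      show "\<beta> < Re s" using s by simp
    qed
    have eq: "?E s t * of_real (?h t $ i $ j) = ?E s t * of_real (f t $ i)" if "t \<in> {0..} - {0}" for t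
      using that by (simp add: columnvector_def)
    have "(\<lambda>t. ?E s t * of_real (?h t $ i $ j)) absolutely_integrable_on {0..}"
      by (rule absolutely_integrable_spike[OF ai, of "{0}"]) (simp, rule eq)
    moreover have "integral {0..} (\<lambda>t. ?E s t * of_real (?h t $ i $ j)) = laplace (\<lambda>t. f t $ i) s"
      unfolding laplace_def by (rule integral_spike[of "{0}", OF _ eq[symmetric]]) auto
    moreover have "H s $ i $ j = H s $ i $ 1"
      by (rule arg_cong) simp
    ultimately show ?thesis using H[of s i] s by (metis max_less_iff_conj)
  qed
  moreover have "continuous_on {0<..} ?h"
  proof (rule continuous_on_eq)
    show "continuous_on {0<..} (\<lambda>t. columnvector (f t) :: real^1^'n)"
      unfolding columnvector_def by (intro continuous_intros continuous_on_subset[OF cont]) auto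
  qed auto
  ultimately show "is_impulse_response H ?h"
    unfolding is_impulse_response_def by (intro conjI) (simp, assumption, blast)
qed

lemma continuous_on_has_vector_derivative:
  "(\<And>t. (f has_vector_derivative f' t) (at t)) \<Longrightarrow> continuous_on A f"
  by (auto intro!: continuous_at_imp_continuous_on has_vector_derivative_continuous)

lemma has_vector_derivative_fst_snd:
  assumes "(f has_vector_derivative (u, v)) (at t)"
  shows "((\<lambda>t. fst (f t)) has_vector_derivative u) (at t)" "((\<lambda>t. snd (f t)) has_vector_derivative v) (at t)"
  using bounded_linear.has_vector_derivative[OF bounded_linear_fst assms]
    bounded_linear.has_vector_derivative[OF bounded_linear_snd assms] by simp_all

text \<open>
  The column \<open>j\<close> of \<open>S\<close> solves \<open>s' = M s + b \<phi>\<^sub>j\<close>, so \<open>S\<close> has the transform \<open>\<Phi> \<Phi>\<^sup>T\<close>, where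
  \<open>\<Phi> = A_plus B\<close> is the transform of \<open>\<phi>\<close>. No convolution is needed.
\<close>

lemma state_sensitivity:
  fixes A :: "real^'n^'n" and B :: "real^1^'n" and K :: "real^'n^1"
  obtains \<phi> S where "\<phi> 0 = column 1 B" "S 0 = 0"
    "\<And>t. (\<phi> has_vector_derivative (A + B ** K) *v \<phi> t) (at t)"
    "\<And>t. (S has_vector_derivative (A + B ** K) ** S t + (\<chi> i j. B $ i $ 1 * \<phi> t $ j)) (at t)"
    "state A B K = (\<lambda>t. if t \<le> 0 then 0 else columnvector (\<phi> t))"
    "\<And>i. impulse_response (\<lambda>s. A_plus A B K s ** complex_matrix B ** rowvector (axis i 1)
        ** A_plus A B K s ** complex_matrix B) = (\<lambda>t. if t \<le> 0 then 0 else columnvector (S t $ i))"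
proof -
  define M where "M = A + B ** K"
  define b where "b = column 1 B"
  \<comment> \<open>The forcing of the sensitivity is linear in the state, so both equations form
    one linear system on pairs, with initial value \<open>(b, 0)\<close>.\<close>
  define L where "L = (\<lambda>(x :: real^'n, X :: real^'n^'n). (M *v x, M ** X + (\<chi> i j. b $ i * x $ j)))"
  have "linear L"
    by (rule linearI)
      (auto simp: L_def vec_eq_iff matrix_matrix_mult_def matrix_vector_mult_def sum_distrib_left
        sum.distrib algebra_simps)
  then obtain y \<beta> where y0: "y 0 = (b, 0)" and dy: "\<And>t. (y has_vector_derivative L (y t)) (at t)"
    and ybd: "\<And>t. t \<ge> 0 \<Longrightarrow> norm (y t) \<le> norm (b, 0 :: real^'n^'n) * exp (\<beta> * t)"
    using linear_ode_solution[of L "(b, 0)"] by auto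
  define C where "C = norm (b, 0 :: real^'n^'n)"
  define \<phi> where "\<phi> t = fst (y t)" for t
  define S where "S t = snd (y t)" for t
  have L_eq: "L (y t) = (M *v \<phi> t, M ** S t + (\<chi> i j. b $ i * \<phi> t $ j))" for t
    by (simp add: L_def \<phi>_def S_def split: prod.split)
  note dy' = has_vector_derivative_fst_snd[OF dy[unfolded L_eq], folded \<phi>_def S_def]
  have d\<phi>: "(\<phi> has_vector_derivative M *v \<phi> t) (at t)" for t
    using dy'(1) unfolding \<phi>_def .
  have dS: "(S has_vector_derivative M ** S t + (\<chi> i j. b $ i * \<phi> t $ j)) (at t)" for t
    using dy'(2) unfolding S_def \<phi>_def .
  have \<phi>bd: "norm (\<phi> t) \<le> C * exp (\<beta> * t)" and Sbd: "norm (S t) \<le> C * exp (\<beta> * t)" if "t \<ge> 0" for t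
    using ybd[OF that] norm_fst_le[of "fst (y t)" "snd (y t)"] norm_snd_le[of "snd (y t)" "fst (y t)"] by (simp_all add: \<phi>_def S_def C_def)
  have \<phi>ibd: "\<bar>\<phi> t $ i\<bar> \<le> C * exp (\<beta> * t)" if "t \<ge> 0" for t i
    using \<phi>bd[OF that] component_le_norm_cart[of "\<phi> t" i] by linarith
  note c\<phi> = continuous_on_has_vector_derivative[OF d\<phi>] and cS = continuous_on_has_vector_derivative[OF dS]
  obtain \<sigma> where inv: "\<And>s. Re s > \<sigma> \<Longrightarrow> invertible (mat s - complex_matrix M)"
    using invertible_resolvent[of M] by blast
  define W where "W s = A_plus A B K s ** complex_matrix B" for s
  define \<Phi> where "\<Phi> s = (\<chi> i. laplace (\<lambda>t. \<phi> t $ i) s)" for s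
  define cb where "cb = (\<chi> i. complex_of_real (b $ i))"
  have resolvent: "v = A_plus A B K s *v w" if "(mat s - complex_matrix M) *v v = w" "Re s > \<sigma>" for v w s
  proof -
    have "matrix_inv (mat s - complex_matrix M) ** (mat s - complex_matrix M) = mat 1"
      using someI_ex[OF inv[OF that(2), unfolded invertible_def]] by (simp add: matrix_inv_def)
    then show ?thesis
      unfolding A_plus_def M_def[symmetric] that(1)[symmetric] by (simp add: matrix_vector_mul_assoc)
  qed
  have W_eq: "W s $ i $ 1 = (A_plus A B K s *v cb) $ i" for s i
    by (simp add: W_def matrix_matrix_mult_def matrix_vector_mult_def cb_def b_def column_def)
  have \<Phi>: "\<Phi> s = A_plus A B K s *v cb" if s: "Re s > max \<sigma> \<beta>" for s
  proof (rule resolvent)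
    have "(mat s - complex_matrix M) *v (\<chi> i. laplace (\<lambda>t. \<phi> t $ i) s)
       = (\<chi> i. of_real (\<phi> 0 $ i)) + laplace (\<lambda>_. 0) s *s (\<chi> i. of_real (b $ i))"
      by (rule laplace_linear_ode[where \<beta> = \<beta> and C = C and C' = 0]) (use d\<phi> \<phi>bd s in auto)
    then show "(mat s - complex_matrix M) *v \<Phi> s = cb"
      by (simp add: \<Phi>_def cb_def laplace_def \<phi>_def y0)
  qed (use s in simp)
  have \<Phi>S: "laplace (\<lambda>t. S t $ i $ j) s = \<Phi> s $ j * \<Phi> s $ i" if s: "Re s > max \<sigma> \<beta>" for s i j
  proof -
    have "((\<lambda>t. column j (S t)) has_vector_derivative M *v column j (S t) + \<phi> t $ j *s b) (at t)" for t
    proof -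
      have bl: "bounded_linear (\<lambda>X :: real^'n^'n. column j X)"
        unfolding column_def linear_conv_bounded_linear[symmetric] by (simp add: linear_iff vec_eq_iff)
      show ?thesis
        using bounded_linear.has_vector_derivative[OF bl dS[of t]]
        by (rule has_vector_derivative_eq_rhs)
          (simp add: vec_eq_iff column_def matrix_matrix_mult_def matrix_vector_mult_def mult.commute)
    qed
    then have "(mat s - complex_matrix M) *v (\<chi> i. laplace (\<lambda>t. column j (S t) $ i) s)
        = (\<chi> i. of_real (column j (S 0) $ i)) + laplace (\<lambda>t. \<phi> t $ j) s *s (\<chi> i. of_real (b $ i))"
    proof (rule laplace_linear_ode)
      show "continuous_on UNIV (\<lambda>t. \<phi> t $ j)" by (intro continuous_intros c\<phi>)
      show "norm (column j (S t)) \<le> C * exp (\<beta> * t)" if "t \<ge> 0" for t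
      proof -
        have "norm (column j (S t)) \<le> norm (S t)"
          unfolding norm_vec_def[of "S t"] norm_vec_def[of "column j (S t)"]
          by (intro L2_set_mono) (simp_all add: column_def component_le_norm_cart)
        then show ?thesis using Sbd[OF that] by linarith
      qed
      show "\<bar>\<phi> t $ j\<bar> \<le> C * exp (\<beta> * t)" if "t \<ge> 0" for t by (rule \<phi>ibd[OF that])
    qed (use s in simp)
    then have "(mat s - complex_matrix M) *v (\<chi> i. laplace (\<lambda>t. S t $ i $ j) s) = \<Phi> s $ j *s cb"
      by (simp add: column_def S_def y0 \<Phi>_def cb_def vec_eq_iff)
    then have "(\<chi> i. laplace (\<lambda>t. S t $ i $ j) s) = A_plus A B K s *v (\<Phi> s $ j *s cb)"
      by (rule resolvent) (use s in simp)
    then show ?thesis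
      by (simp add: \<Phi>[OF s] vec.scale vec_eq_iff)
  qed
  have st: "state A B K = (\<lambda>t. if t \<le> 0 then 0 else columnvector (\<phi> t))"
    unfolding state_def W_def[symmetric]
  proof (rule impulse_response_columnvector[OF c\<phi> \<phi>bd])
    fix s i assume s: "Re s > max \<sigma> \<beta>"
    show "laplace (\<lambda>t. \<phi> t $ i) s = W s $ i $ 1"
      unfolding W_eq \<Phi>[OF s, symmetric] by (simp add: \<Phi>_def)
  qed
  \<comment> \<open>The transform of \<open>S $ i $ j\<close> is a product symmetric in
    \<open>i\<close> and \<open>j\<close>. Hence the response belonging to the unit vector
    \<open>i\<close> can be read off row \<open>i\<close> of \<open>S\<close>, the row holding the
    derivatives of the state component \<open>i\<close>.\<close>
  have ir: "impulse_response (\<lambda>s. A_plus A B K s ** complex_matrix B ** rowvector (axis i 1)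
        ** A_plus A B K s ** complex_matrix B) = (\<lambda>t. if t \<le> 0 then 0 else columnvector (S t $ i))" for i
  proof (rule impulse_response_columnvector)
    show "continuous_on UNIV (\<lambda>t. S t $ i)" by (intro continuous_intros cS)
    show "norm (S t $ i) \<le> C * exp (\<beta> * t)" if "t \<ge> 0" for t
      using Sbd[OF that] Finite_Cartesian_Product.norm_nth_le[of "S t" i] by linarith
    fix s j assume s: "Re s > max \<sigma> \<beta>"
    have "(A_plus A B K s ** complex_matrix B ** rowvector (axis i 1)
        ** A_plus A B K s ** complex_matrix B) $ j $ 1 = (W s ** (rowvector (axis i 1) ** W s)) $ j $ 1"
      by (simp add: W_def matrix_mul_assoc)
    also have "\<dots> = W s $ j $ 1 * W s $ i $ 1"
      by (simp add: matrix_matrix_mult_def rowvector_def axis_def if_distrib[of "\<lambda>x. x * _"] cong: if_cong)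
    finally show "laplace (\<lambda>t. S t $ i $ j) s = (A_plus A B K s ** complex_matrix B ** rowvector (axis i 1)
        ** A_plus A B K s ** complex_matrix B) $ j $ 1"
      by (simp add: \<Phi>S[OF s] W_eq \<Phi>[OF s])
  qed
  show thesis
    using that[of \<phi> S] d\<phi> dS st ir y0
    by (simp add: M_def b_def \<phi>_def S_def column_def)
qed

subsection \<open>Perturbation of the feedback gain\<close>

lemma bounded_linear_matrix_vector_mult_left: "bounded_linear (\<lambda>X :: real^'n^'m. X *v d)"
  unfolding linear_conv_bounded_linear[symmetric]
  by (rule linearI) (simp_all add: matrix_vector_mult_add_rdistrib scaleR_matrix_vector_assoc)

text \<open>\<psi>, the difference \<psi> - \<phi> and the remainder all satisfy the equation of
  \<open>M\<close>, forced along \<open>b\<close> by \<psi>, \<psi> and \<psi> - \<phi>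
  respectively. A small-gain argument bounds \<psi> uniformly in \<open>d\<close>; the other two
  bounds follow in turn.\<close>

lemma perturbation_bounds:
  fixes M :: "real^'n^'n" and b :: "real^'n"
  assumes "hurwitz M"
    and \<phi>0: "\<phi> 0 = b" and d\<phi>: "\<And>t. (\<phi> has_vector_derivative M *v \<phi> t) (at t)"
    and S0: "S 0 = 0" and dS: "\<And>t. (S has_vector_derivative M ** S t + (\<chi> i j. b $ i * \<phi> t $ j)) (at t)"
  obtains C a \<delta> where "C > 0" "a > 0" "\<delta> > 0"
    "\<And>t. t \<ge> 0 \<Longrightarrow> norm (\<phi> t) \<le> C * exp (- a * t)"
    "\<And>t. t \<ge> 0 \<Longrightarrow> norm (S t) \<le> C * exp (- a * t)"
    "\<And>\<psi> d t. \<psi> 0 = b \<Longrightarrow> (\<And>t. (\<psi> has_vector_derivative M *v \<psi> t + (d \<bullet> \<psi> t) *\<^sub>R b) (at t)) \<Longrightarrow>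
       norm d < \<delta> \<Longrightarrow> t \<ge> 0 \<Longrightarrow> norm (\<psi> t - \<phi> t) \<le> C * norm d * exp (- a * t) \<and>
       norm (\<psi> t - \<phi> t - S t *v d) \<le> C * (norm d)\<^sup>2 * exp (- a * t)"
proof -
  obtain C\<^sub>0 a where C\<^sub>0: "C\<^sub>0 > 0" and a: "a > 0" and bd: "\<And>y g T c t.
      (\<And>t. (y has_vector_derivative M *v y t + g t) (at t)) \<Longrightarrow>
      (\<And>t. t \<in> {0..T} \<Longrightarrow> norm (g t) \<le> c * exp (- a * t)) \<Longrightarrow> t \<in> {0..T} \<Longrightarrow>
      norm (y t) \<le> C\<^sub>0 * (norm (y 0) + c) * exp (- a * t)"
    using hurwitz_forced_bound[OF assms(1)] by blast
  define B where "B = C\<^sub>0 * norm b"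
  have B: "B \<ge> 0" using C\<^sub>0 by (simp add: B_def)
  \<comment> \<open>Chosen to give \<open>B * norm d \<le> 1 / 2\<close>; the summand 1 keeps the
    denominator positive when \<open>B = 0\<close>.\<close>
  define \<delta> where "\<delta> = 1 / (2 * (B + 1))"
  have \<delta>: "\<delta> > 0" using B by (simp add: \<delta>_def)
  \<comment> \<open>A response from rest to the scalar input \<open>d \<bullet> x\<close> gains the
    factor \<open>B * norm d\<close> over \<open>x\<close>. It is used with \<phi>, \<psi> and
    \<psi> - \<phi> in the role of \<open>x\<close>.\<close>
  have input: "norm (y t) \<le> B * norm d * c * exp (- a * t)"
    if "y 0 = 0" "\<And>t. (y has_vector_derivative M *v y t + (d \<bullet> x t) *\<^sub>R b) (at t)"
      "\<And>t. t \<ge> 0 \<Longrightarrow> norm (x t) \<le> c * exp (- a * t)" "t \<ge> 0" for y x d c t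
  proof -
    have "norm ((d \<bullet> x t) *\<^sub>R b) \<le> norm d * norm b * c * exp (- a * t)" if "t \<in> {0..t'}" for t t'
    proof -
      have "\<bar>d \<bullet> x t\<bar> \<le> norm d * (c * exp (- a * t))"
        using Cauchy_Schwarz_ineq2[of d "x t"] mult_left_mono[OF \<open>\<And>t. t \<ge> 0 \<Longrightarrow> norm (x t) \<le> _\<close>[of t], of "norm d"] that
        by simp
      from mult_right_mono[OF this, of "norm b"] show ?thesis by (simp add: mult_ac)
    qed
    then have "norm (y t) \<le> C\<^sub>0 * (norm (y 0) + norm d * norm b * c) * exp (- a * t)"
      using that by (intro bd[where T = t]) auto
    then show ?thesis using that(1) by (simp add: B_def mult_ac)
  qed
  have b\<phi>: "norm (\<phi> t) \<le> B * exp (- a * t)" if "t \<ge> 0" for t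
    using bd[of \<phi> "\<lambda>_. 0" t 0 t] d\<phi> \<phi>0 that by (simp add: B_def)
  have dSv: "((\<lambda>t. S t *v d) has_vector_derivative M *v (S t *v d) + (d \<bullet> \<phi> t) *\<^sub>R b) (at t)" for d t
  proof -
    have "(\<chi> i j. b $ i * \<phi> t $ j) *v d = (d \<bullet> \<phi> t) *\<^sub>R b"
      by (simp add: vec_eq_iff matrix_vector_mult_def inner_vec_def sum_distrib_left sum_distrib_right mult_ac)
    then show ?thesis
      using bounded_linear.has_vector_derivative[OF bounded_linear_matrix_vector_mult_left[of d] dS[of t]]
      by (simp add: matrix_vector_mult_add_rdistrib matrix_vector_mul_assoc)
  qed
  have bSv: "norm (S t *v d) \<le> B * norm d * B * exp (- a * t)" if "t \<ge> 0" for t d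
    using S0 by (intro input[OF _ dSv b\<phi> that]) auto
  define N where "N = real CARD('n)"
  \<comment> \<open>Column \<open>j\<close> of \<open>S\<close> is \<open>S\<close> applied to a
    unit vector, so \<open>bSv\<close> bounds each entry.\<close>
  have bS: "norm (S t) \<le> N * N * B\<^sup>2 * exp (- a * t)" if "t \<ge> 0" for t
  proof -
    have "\<bar>S t $ i $ j\<bar> \<le> B\<^sup>2 * exp (- a * t)" for i j
    proof -
      have "S t $ i $ j = (S t *v axis j 1) $ i"
        by (simp add: matrix_vector_mul_component inner_axis)
      then have "\<bar>S t $ i $ j\<bar> \<le> norm (S t *v axis j 1)"
        using component_le_norm_cart by metis
      also have "\<dots> \<le> B\<^sup>2 * exp (- a * t)"
        using bSv[OF that, of "axis j 1"] by (simp add: norm_axis_1 power2_eq_square)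
      finally show ?thesis .
    qed
    then have "norm (S t $ i) \<le> (\<Sum>j\<in>(UNIV :: 'n set). B\<^sup>2 * exp (- a * t))" for i
      by (intro order_trans[OF norm_le_l1_cart] sum_mono)
    then have "norm (S t) \<le> (\<Sum>i\<in>(UNIV :: 'n set). \<Sum>j\<in>(UNIV :: 'n set). B\<^sup>2 * exp (- a * t))"
      unfolding norm_vec_def[of "S t"] by (intro order_trans[OF L2_set_le_sum] sum_mono) auto
    then show ?thesis by (simp add: N_def mult_ac)
  qed
  \<comment> \<open>The summands serve the bounds on \<phi>, \<psi> - \<phi>, the remainder and
    \<open>S\<close>, in this order; the 1 makes \<open>C\<close> positive.\<close>
  define C where "C = B + 2 * B\<^sup>2 + 2 * B ^ 3 + N * N * B\<^sup>2 + 1"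
  have N: "N \<ge> 0" by (simp add: N_def)
  have C: "C > 0" "B \<le> C" "2 * B\<^sup>2 \<le> C" "2 * B ^ 3 \<le> C" "N * N * B\<^sup>2 \<le> C"
    using B N unfolding C_def by (simp_all add: add_nonneg_pos add_increasing add_increasing2)
  have pert: "norm (\<psi> t - \<phi> t) \<le> C * norm d * exp (- a * t) \<and>
       norm (\<psi> t - \<phi> t - S t *v d) \<le> C * (norm d)\<^sup>2 * exp (- a * t)"
    if \<psi>0: "\<psi> 0 = b" and d\<psi>: "\<And>t. (\<psi> has_vector_derivative M *v \<psi> t + (d \<bullet> \<psi> t) *\<^sub>R b) (at t)"
      and d: "norm d < \<delta>" and t: "t \<ge> 0" for \<psi> d t
  proof -
    \<comment> \<open>Small gain: let \<open>m\<close> be the maximum of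
      \<open>norm (\<psi> t) * exp (a * t)\<close> on \<open>{0..T}\<close>, attained by
      compactness. The forced estimate at the maximiser gives \<open>m \<le> B + m / 2\<close>, so
      \<open>m \<le> 2 * B\<close> whatever \<open>T\<close> is.\<close>
    have b\<psi>: "norm (\<psi> T) \<le> 2 * B * exp (- a * T)" if T: "T \<ge> 0" for T
    proof -
      have "continuous_on {0..T} (\<lambda>t. norm (\<psi> t) * exp (a * t))"
        by (intro continuous_intros continuous_on_has_vector_derivative[OF d\<psi>])
      then obtain s where s: "s \<in> {0..T}" and max: "\<And>t. t \<in> {0..T} \<Longrightarrow>
          norm (\<psi> t) * exp (a * t) \<le> norm (\<psi> s) * exp (a * s)"
        using continuous_attains_sup[of "{0..T}" "\<lambda>t. norm (\<psi> t) * exp (a * t)"] T by force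
      define m where "m = norm (\<psi> s) * exp (a * s)"
      have le: "norm (\<psi> t) \<le> m * exp (- a * t)" if "t \<in> {0..T}" for t
      proof -
        have "norm (\<psi> t) = norm (\<psi> t) * exp (a * t) * exp (- a * t)"
          by (simp add: mult.assoc flip: exp_add)
        also have "\<dots> \<le> m * exp (- a * t)"
          using max[OF that] by (intro mult_right_mono) (auto simp: m_def)
        finally show ?thesis .
      qed
      have "norm ((d \<bullet> \<psi> t) *\<^sub>R b) \<le> norm d * norm b * m * exp (- a * t)" if "t \<in> {0..T}" for t
      proof -
        have "\<bar>d \<bullet> \<psi> t\<bar> \<le> norm d * (m * exp (- a * t))"
          using Cauchy_Schwarz_ineq2[of d "\<psi> t"] mult_left_mono[OF le[OF that], of "norm d"] by simp
        from mult_right_mono[OF this, of "norm b"] show ?thesis by (simp add: mult_ac)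
      qed
      then have "norm (\<psi> s) \<le> C\<^sub>0 * (norm (\<psi> 0) + norm d * norm b * m) * exp (- a * s)"
        using d\<psi> s by (intro bd[where T = T]) auto
      then have "m \<le> C\<^sub>0 * (norm b + norm d * norm b * m) * exp (- a * s) * exp (a * s)"
        unfolding m_def \<psi>0 by (intro mult_right_mono) auto
      also have "\<dots> = B + B * norm d * m"
        by (simp add: B_def algebra_simps flip: exp_add)
      also have "B * norm d * m \<le> 1 / 2 * m"
      proof (rule mult_right_mono)
        have "B * norm d \<le> (B + 1) * \<delta>" using B d by (intro mult_mono) auto
        also have "\<dots> = 1 / 2" using B by (simp add: \<delta>_def)
        finally show "B * norm d \<le> 1 / 2" .
      qed (simp add: m_def)
      finally have "m \<le> 2 * B" by simp
      then show ?thesis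
        using T by (intro order_trans[OF le] mult_right_mono) auto
    qed
    have de: "((\<lambda>t. \<psi> t - \<phi> t) has_vector_derivative M *v (\<psi> t - \<phi> t) + (d \<bullet> \<psi> t) *\<^sub>R b) (at t)" for t
      using has_vector_derivative_diff[OF d\<psi>[of t] d\<phi>[of t]]
      by (simp add: matrix_vector_mult_diff_distrib algebra_simps)
    have be: "norm (\<psi> t - \<phi> t) \<le> B * norm d * (2 * B) * exp (- a * t)" if "t \<ge> 0" for t
      using \<psi>0 \<phi>0 by (intro input[OF _ de b\<psi> that]) auto
    \<comment> \<open>Subtracting \<open>S t *v d\<close> replaces the forcing
      \<open>d \<bullet> \<psi>\<close> by \<open>d \<bullet> (\<psi> - \<phi>)\<close>, which is
      already of second order.\<close>
    have d\<rho>: "((\<lambda>t. \<psi> t - \<phi> t - S t *v d) has_vector_derivative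
        M *v (\<psi> t - \<phi> t - S t *v d) + (d \<bullet> (\<psi> t - \<phi> t)) *\<^sub>R b) (at t)" for t
      using has_vector_derivative_diff[OF de[of t] dSv[of d t]]
      by (simp add: matrix_vector_mult_diff_distrib algebra_simps)
    have "norm (\<psi> t - \<phi> t - S t *v d) \<le> B * norm d * (B * norm d * (2 * B)) * exp (- a * t)"
      using \<psi>0 \<phi>0 S0 by (intro input[OF _ d\<rho> be t]) auto
    also have "\<dots> = 2 * B ^ 3 * (norm d)\<^sup>2 * exp (- a * t)" by (simp add: power2_eq_square power3_eq_cube)
    also have "\<dots> \<le> C * (norm d)\<^sup>2 * exp (- a * t)" using C by (intro mult_right_mono) auto
    finally have 2: "norm (\<psi> t - \<phi> t - S t *v d) \<le> C * (norm d)\<^sup>2 * exp (- a * t)" .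
    have "norm (\<psi> t - \<phi> t) \<le> 2 * B\<^sup>2 * norm d * exp (- a * t)"
      using be[OF t] by (simp add: power2_eq_square mult_ac)
    also have "\<dots> \<le> C * norm d * exp (- a * t)" using C by (intro mult_right_mono) auto
    finally show ?thesis using 2 by simp
  qed
  show thesis
  proof (rule that[of C a \<delta>])
    show "norm (\<phi> t) \<le> C * exp (- a * t)" if "t \<ge> 0" for t
      by (rule order_trans[OF b\<phi>[OF that] mult_right_mono[OF C(2)]]) simp
    show "norm (S t) \<le> C * exp (- a * t)" if "t \<ge> 0" for t
      by (rule order_trans[OF bS[OF that] mult_right_mono[OF C(5)]]) simp
  qed (rule C(1) a \<delta> pert; assumption)+
qed

section \<open>Gradients from quadratic remainders, and integrability of products\<close>

lemma GDERIV_quadratic_bound: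
  fixes f :: "'a::real_inner \<Rightarrow> real"
  assumes "\<delta> > 0" "\<And>h. norm h < \<delta> \<Longrightarrow> \<bar>f (x + h) - f x - h \<bullet> G\<bar> \<le> C * (norm h)\<^sup>2"
  shows "GDERIV f x :> G"
  unfolding gderiv_def has_derivative_at
proof (intro conjI bounded_linear_inner_left)
  have "((\<lambda>h :: 'a. C * norm h) \<longlongrightarrow> C * norm (0 :: 'a)) (at 0)" by (intro tendsto_intros)
  then have "((\<lambda>h :: 'a. C * norm h) \<longlongrightarrow> 0) (at 0)" by simp
  moreover have "\<forall>\<^sub>F h in at 0. norm (norm (f (x + h) - f x - h \<bullet> G) / norm h) \<le> C * norm h"
    unfolding eventually_at using assms
    by (intro exI[of _ \<delta>]) (auto simp: divide_le_eq power2_eq_square mult_ac)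
  ultimately show "(\<lambda>h. norm (f (x + h) - f x - h \<bullet> G) / norm h) \<midarrow>0\<rightarrow> 0"
    by (rule Lim_null_comparison[rotated])
qed

lemma gradient_eqI:
  assumes "GDERIV f K :> G"
  shows "gradient f K = G"
  unfolding gradient_def
proof (rule the_equality[where P = "\<lambda>G. GDERIV f K :> G", OF assms])
  fix H assume "GDERIV f K :> H"
  then have "(\<lambda>h. h \<bullet> H) = (\<lambda>h. h \<bullet> G)"
    using assms unfolding gderiv_def by (rule has_derivative_unique)
  then have "(H - G) \<bullet> H = (H - G) \<bullet> G" by metis
  then have "(H - G) \<bullet> (H - G) = 0" by (simp add: inner_diff_right[of "H - G" H G])
  then show "H = G" by simp
qed

lemma bilinear_exp_bound_integrable:
  fixes f :: "real \<Rightarrow> 'a::euclidean_space" and g :: "real \<Rightarrow> 'b::euclidean_space"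
    and h :: "'a \<Rightarrow> 'b \<Rightarrow> 'c::euclidean_space"
  assumes "bilinear h" "a > 0" "continuous_on {0<..} f" "continuous_on {0<..} g"
    and f: "\<And>t. t > 0 \<Longrightarrow> norm (f t) \<le> C * exp (- a * t)"
    and g: "\<And>t. t > 0 \<Longrightarrow> norm (g t) \<le> C' * exp (- a * t)"
  shows "(\<lambda>t. h (f t) (g t)) absolutely_integrable_on {0..}"
proof -
  have bb: "bounded_bilinear h" using assms(1) by (simp add: bilinear_conv_bounded_bilinear)
  obtain k where k: "k > 0" "\<And>x y. norm (h x y) \<le> norm x * norm y * k"
    using bounded_bilinear.pos_bounded[OF bb] by auto
  show ?thesis
  proof (rule absolutely_integrable_exp_bound)
    show "continuous_on {0<..} (\<lambda>t. h (f t) (g t))"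
      by (intro bounded_bilinear.continuous_on[OF bb] assms)
    show "2 * a > 0" using assms by simp
    fix t :: real assume t: "t > 0"
    have "norm (h (f t) (g t)) \<le> norm (f t) * norm (g t) * k" by (rule k)
    also have "\<dots> \<le> (C * exp (- a * t)) * (C' * exp (- a * t)) * k"
      using k(1) f[OF t] g[OF t] order_trans[OF norm_ge_zero f[OF t]]
      by (intro mult_right_mono mult_mono) auto
    finally show "norm (h (f t) (g t)) \<le> C * C' * k * exp (- (2 * a) * t)"
      by (simp add: algebra_simps flip: exp_add)
  qed
qed

subsection \<open>The gradient of the cost\<close>

lemma norm_row_matrix: "norm D = norm (D $ 1)" for D :: "real^'n^1"
  by (simp add: norm_vec_def[of D])

lemma inner_row_matrix: "D \<bullet> G = D $ 1 \<bullet> G $ 1" for D G :: "real^'n^1"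
  by (simp add: inner_vec_def[of D])

text \<open>Brings the perturbed closed loop into the form required by
  \<open>perturbation_bounds\<close>, with \<open>d = D $ 1\<close>.\<close>

lemma closed_loop_perturbation:
  fixes B :: "real^1^'n"
  shows "(A + B ** (K + D)) *v v = (A + B ** K) *v v + (D $ 1 \<bullet> v) *\<^sub>R column 1 B"
  by (simp add: vec_eq_iff matrix_vector_mult_def matrix_matrix_mult_def column_def inner_vec_def
      algebra_simps sum.distrib sum_distrib_left)

lemma rowvector_nth [simp]: "rowvector v $ i = v"
  by (simp add: rowvector_def vec_eq_iff)

lemma running_cost_columnvector:
  fixes x :: "real^'n"
  assumes "state A B K t = columnvector x"
  shows "running_cost A B Q R K t = 1/2 * (x \<bullet> (Q *v x) + R * (K $ 1 \<bullet> x)\<^sup>2)"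
proof -
  have "(transpose (columnvector x :: real^1^'n) ** Q ** (columnvector x :: real^1^'n)) $ 1 $ 1
    = x \<bullet> (Q *v x)"
    by (simp add: transpose_columnvector dot_matrix_product dot_rowvector_columnvector matrix_mul_assoc)
  moreover have "(K ** (columnvector x :: real^1^'n)) $ 1 $ 1 = K $ 1 \<bullet> x"
    by (simp add: matrix_matrix_mult_def columnvector_def inner_vec_def)
  ultimately show ?thesis
    by (simp add: running_cost_def feedback_def assms power2_eq_square)
qed

lemma columnvector_0 [simp]: "columnvector 0 = 0"
  by (simp add: columnvector_def vec_eq_iff)

text \<open>The polarised running cost, so that integrability comes from the general statement on
  products of decaying functions.\<close>

lemma bilinear_running_cost:
  "bilinear (\<lambda>x y :: real^'n. 1/2 * (x \<bullet> (Q *v y) + R * ((k \<bullet> x) * (k \<bullet> y))))"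
  by (auto simp: bilinear_def linear_iff algebra_simps add_divide_distrib inner_add_left inner_add_right
      matrix_vector_right_distrib matrix_vector_mult_scaleR)

lemma bilinear_cross_cost:
  "bilinear (\<lambda>x (X :: real^'n^'n). transpose (columnvector x :: real^1^'n) ** Q ** X)"
  by (auto simp: bilinear_def linear_iff vec_eq_iff transpose_def columnvector_def matrix_matrix_mult_def
      algebra_simps sum.distrib sum_distrib_left sum_distrib_right)

text \<open>Joining state and sensitivity into one second argument makes the control term, quadratic
  in this data, bilinear.\<close>

lemma bilinear_control_cost:
  "bilinear (\<lambda>x (y, Y :: real^'n^'n). (k \<bullet> x * R) *\<^sub>R (transpose (columnvector y :: real^1^'n) + K ** Y))"
  by (auto simp: bilinear_def linear_iff vec_eq_iff transpose_def columnvector_def matrix_matrix_mult_def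
      inner_add_right algebra_simps sum.distrib sum_distrib_left)

text \<open>Pairing the gradient integrand with \<open>D\<close> must give the directional
  derivative, in which the sensitivity acts on \<open>D $ 1\<close>.\<close>

lemma inner_cross_cost:
  fixes D :: "real^'n^1" and x :: "real^'n"
  shows "D \<bullet> (transpose (columnvector x) ** Q ** X) = x \<bullet> (Q *v (X *v D $ 1))"
proof -
  have "transpose (columnvector x :: real^1^'n) ** Q ** X = rowvector ((x v* Q) v* X)"
    by (simp add: transpose_columnvector vec_eq_iff rowvector_def matrix_matrix_mult_def
        vector_matrix_mult_def mult.commute)
  then show ?thesis
    by (simp add: inner_row_matrix dot_lmul_matrix inner_commute[of "D $ 1"])
qed

lemma inner_control_cost:
  fixes D K :: "real^'n^1" and x :: "real^'n"
  shows "D \<bullet> (transpose (columnvector x) + K ** X) = D $ 1 \<bullet> x + K $ 1 \<bullet> (X *v D $ 1)"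
proof -
  have "transpose (columnvector x :: real^1^'n) + K ** X = rowvector (x + K $ 1 v* X)"
    by (simp add: transpose_columnvector vec_eq_iff rowvector_def matrix_matrix_mult_def
        vector_matrix_mult_def mult.commute)
  then show ?thesis
    by (simp add: inner_row_matrix inner_add_right dot_lmul_matrix inner_commute[of "D $ 1"])
qed

lemma symmetric_inner_commute:
  fixes Q :: "real^'n^'n"
  assumes "transpose Q = Q"
  shows "x \<bullet> (Q *v y) = y \<bullet> (Q *v x)"
proof -
  have "x v* Q = Q *v x" using transpose_matrix_vector[of Q x] assms by simp
  then show ?thesis
    using dot_lmul_matrix[of x Q y] inner_commute[of "Q *v x" y] by simp
qed

text \<open>
  With \<open>e = \<psi> - \<phi>\<close> of first order and \<open>\<rho> = e - \<eta>\<close> of second order in \<open>d\<close>, everything left over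
  from the linearisation is of second order.
\<close>

lemma running_cost_remainder:
  fixes \<phi> \<psi> \<eta> d k :: "real^'n"
  assumes sym: "transpose Q = Q"
    and q: "\<And>x y. \<bar>x \<bullet> (Q *v y)\<bar> \<le> q * norm x * norm y"
    and nonneg: "q \<ge> 0" "C \<ge> 0" "E \<ge> 0"
    and d: "norm d \<le> \<delta>"
    and \<phi>: "norm \<phi> \<le> C * E" and e: "norm (\<psi> - \<phi>) \<le> C * norm d * E"
    and \<rho>: "norm (\<psi> - \<phi> - \<eta>) \<le> C * (norm d)\<^sup>2 * E"
  shows "\<bar>1/2 * (\<psi> \<bullet> (Q *v \<psi>) + R * ((k + d) \<bullet> \<psi>)\<^sup>2) - 1/2 * (\<phi> \<bullet> (Q *v \<phi>) + R * (k \<bullet> \<phi>)\<^sup>2)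
      - (\<phi> \<bullet> (Q *v \<eta>) + k \<bullet> \<phi> * R * (d \<bullet> \<phi> + k \<bullet> \<eta>))\<bar>
    \<le> (2 * q * C\<^sup>2 + \<bar>R\<bar> * (C * (norm k + 1 + \<delta>))\<^sup>2 + \<bar>R\<bar> * (norm k * C * (norm k * C + C))) * (norm d)\<^sup>2 * E\<^sup>2"
proof -
  define e where "e = \<psi> - \<phi>"
  define \<rho> where "\<rho> = \<psi> - \<phi> - \<eta>"
  note b = e[folded e_def] \<rho>[folded \<rho>_def]
  have \<psi>: "\<psi> = \<phi> + e" and \<eta>: "\<eta> = e - \<rho>" by (simp_all add: e_def \<rho>_def)
  \<comment> \<open>\<open>v\<close> is the exact change of the feedback signal and \<open>w\<close>
    the part of it beyond its linearisation
    \<open>d \<bullet> \<phi> + k \<bullet> \<eta>\<close>.\<close>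
  define v where "v = k \<bullet> e + d \<bullet> \<phi> + d \<bullet> e"
  define w where "w = k \<bullet> \<rho> + d \<bullet> e"
  have "1/2 * (\<psi> \<bullet> (Q *v \<psi>) + R * ((k + d) \<bullet> \<psi>)\<^sup>2) - 1/2 * (\<phi> \<bullet> (Q *v \<phi>) + R * (k \<bullet> \<phi>)\<^sup>2)
      - (\<phi> \<bullet> (Q *v \<eta>) + k \<bullet> \<phi> * R * (d \<bullet> \<phi> + k \<bullet> \<eta>))
    = 1/2 * (e \<bullet> (Q *v e)) + \<phi> \<bullet> (Q *v \<rho>) + 1/2 * (R * v\<^sup>2) + R * (k \<bullet> \<phi> * w)"
  proof -
    have 1: "\<psi> \<bullet> (Q *v \<psi>) = \<phi> \<bullet> (Q *v \<phi>) + 2 * (\<phi> \<bullet> (Q *v e)) + e \<bullet> (Q *v e)"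
      using symmetric_inner_commute[OF sym, of e \<phi>]
      by (simp add: \<psi> matrix_vector_right_distrib inner_add_left inner_add_right)
    have 2: "(k + d) \<bullet> \<psi> = k \<bullet> \<phi> + v"
      by (simp add: \<psi> v_def inner_add_left inner_add_right)
    have 3: "\<phi> \<bullet> (Q *v \<eta>) = \<phi> \<bullet> (Q *v e) - \<phi> \<bullet> (Q *v \<rho>)"
      by (simp add: \<eta> matrix_vector_mult_diff_distrib inner_diff_right)
    have 4: "d \<bullet> \<phi> + k \<bullet> \<eta> = v - w"
      by (simp add: \<eta> v_def w_def inner_diff_right)
    show ?thesis unfolding 1 2 3 4 by (simp add: power2_eq_square algebra_simps add_divide_distrib)
  qed
  also have "\<bar>\<dots>\<bar> \<le> \<bar>e \<bullet> (Q *v e)\<bar> + \<bar>\<phi> \<bullet> (Q *v \<rho>)\<bar> + \<bar>R\<bar> * v\<^sup>2 + \<bar>R\<bar> * (\<bar>k \<bullet> \<phi>\<bar> * \<bar>w\<bar>)"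
  proof -
    have "\<bar>R * v\<^sup>2\<bar> = \<bar>R\<bar> * v\<^sup>2" "\<bar>R * (k \<bullet> \<phi> * w)\<bar> = \<bar>R\<bar> * (\<bar>k \<bullet> \<phi>\<bar> * \<bar>w\<bar>)" by (simp_all add: abs_mult)
    then show ?thesis by linarith
  qed
  also have "\<dots> \<le> q * C\<^sup>2 * (norm d)\<^sup>2 * E\<^sup>2 + q * C\<^sup>2 * (norm d)\<^sup>2 * E\<^sup>2
      + \<bar>R\<bar> * (C * (norm k + 1 + \<delta>) * norm d * E)\<^sup>2
      + \<bar>R\<bar> * ((norm k * (C * E)) * ((norm k * C + C) * (norm d)\<^sup>2 * E))"
  proof (intro add_mono mult_left_mono)
    have "\<bar>e \<bullet> (Q *v e)\<bar> \<le> q * norm e * norm e" by (rule q)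
    also have "\<dots> \<le> q * (C * norm d * E) * (C * norm d * E)"
      using b nonneg by (intro mult_mono) auto
    finally show "\<bar>e \<bullet> (Q *v e)\<bar> \<le> q * C\<^sup>2 * (norm d)\<^sup>2 * E\<^sup>2" by (simp add: power2_eq_square mult_ac)
    have "\<bar>\<phi> \<bullet> (Q *v \<rho>)\<bar> \<le> q * norm \<phi> * norm \<rho>" by (rule q)
    also have "\<dots> \<le> q * (C * E) * (C * (norm d)\<^sup>2 * E)"
      using b \<phi> nonneg by (intro mult_mono) auto
    finally show "\<bar>\<phi> \<bullet> (Q *v \<rho>)\<bar> \<le> q * C\<^sup>2 * (norm d)\<^sup>2 * E\<^sup>2" by (simp add: power2_eq_square mult_ac)
    have "\<bar>v\<bar> \<le> norm k * norm e + norm d * norm \<phi> + norm d * norm e"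
      using Cauchy_Schwarz_ineq2[of k e] Cauchy_Schwarz_ineq2[of d \<phi>] Cauchy_Schwarz_ineq2[of d e]
      unfolding v_def by linarith
    also have "\<dots> \<le> norm k * (C * norm d * E) + norm d * (C * E) + \<delta> * (C * norm d * E)"
      using b \<phi> d order_trans[OF norm_ge_zero d] by (intro add_mono mult_mono) auto
    also have "\<dots> = C * (norm k + 1 + \<delta>) * norm d * E" by (simp add: algebra_simps)
    finally show "v\<^sup>2 \<le> (C * (norm k + 1 + \<delta>) * norm d * E)\<^sup>2"
      by (rule abs_le_square_iff[THEN iffD1, OF order_trans[OF _ abs_ge_self]])
    have "\<bar>w\<bar> \<le> norm k * norm \<rho> + norm d * norm e"
      using Cauchy_Schwarz_ineq2[of k \<rho>] Cauchy_Schwarz_ineq2[of d e] unfolding w_def by linarith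
    also have "\<dots> \<le> norm k * (C * (norm d)\<^sup>2 * E) + norm d * (C * norm d * E)"
      using b by (intro add_mono mult_left_mono) auto
    finally have w: "\<bar>w\<bar> \<le> (norm k * C + C) * (norm d)\<^sup>2 * E"
      by (simp add: algebra_simps power2_eq_square)
    have "\<bar>k \<bullet> \<phi>\<bar> \<le> norm k * (C * E)"
      using Cauchy_Schwarz_ineq2[of k \<phi>] mult_left_mono[OF \<phi>, of "norm k"] by simp
    then show "\<bar>k \<bullet> \<phi>\<bar> * \<bar>w\<bar> \<le> norm k * (C * E) * ((norm k * C + C) * (norm d)\<^sup>2 * E)"
      using w nonneg by (intro mult_mono) auto
  qed auto
  also have "\<dots> = (2 * q * C\<^sup>2 + \<bar>R\<bar> * (C * (norm k + 1 + \<delta>))\<^sup>2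
      + \<bar>R\<bar> * (norm k * C * (norm k * C + C))) * (norm d)\<^sup>2 * E\<^sup>2"
    by algebra
  finally show ?thesis .
qed

theorem theorem1:
  fixes A Q :: "real^'n^'n" and B :: "real^1^'n" and R :: real and K :: "real^'n^1"
  assumes "pos_semidef Q"
    and "R > 0"
    and "stabilizable A B"
    and "detectable A (matrix_sqrt Q)"
    and "hurwitz (A + B ** K)"
  defines "x \<equiv> state A B K" and "u \<equiv> feedback A B K" and "dx \<equiv> dstate A B K"
  shows "(\<forall>i t. GDERIV (\<lambda>K'. state A B K' t $ i $ 1) K :>
             transpose (impulse_response
               (\<lambda>s. A_plus A B K s ** complex_matrix B ** rowvector (axis i 1)
                      ** A_plus A B K s ** complex_matrix B) t)) \<and>
         running_cost A B Q R K absolutely_integrable_on {0..} \<and>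
         (\<lambda>t. transpose (x t) ** Q ** dx t) absolutely_integrable_on {0..} \<and>
         (\<lambda>t. (u t * R) *\<^sub>R (transpose (x t) + K ** dx t)) absolutely_integrable_on {0..} \<and>
         GDERIV (cost A B Q R) K :>
           integral {0..} (\<lambda>t. transpose (x t) ** Q ** dx t)
           + integral {0..} (\<lambda>t. (u t * R) *\<^sub>R (transpose (x t) + K ** dx t))"
proof -
  let ?b = "column 1 B"
  obtain \<phi> S where \<phi>0: "\<phi> 0 = ?b" and S0: "S 0 = 0"
    and d\<phi>: "\<And>t. (\<phi> has_vector_derivative (A + B ** K) *v \<phi> t) (at t)"
    and dS: "\<And>t. (S has_vector_derivative (A + B ** K) ** S t + (\<chi> i j. B $ i $ 1 * \<phi> t $ j)) (at t)"
    and st: "state A B K = (\<lambda>t. if t \<le> 0 then 0 else columnvector (\<phi> t))"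
    and ir: "\<And>i. impulse_response (\<lambda>s. A_plus A B K s ** complex_matrix B ** rowvector (axis i 1)
        ** A_plus A B K s ** complex_matrix B) = (\<lambda>t. if t \<le> 0 then 0 else columnvector (S t $ i))"
    by (rule state_sensitivity[of B A K]) (rule that, assumption+)
  obtain C a \<delta> where C: "C > 0" and a: "a > 0" and \<delta>: "\<delta> > 0"
    and b\<phi>: "\<And>t. t \<ge> 0 \<Longrightarrow> norm (\<phi> t) \<le> C * exp (- a * t)"
    and bS: "\<And>t. t \<ge> 0 \<Longrightarrow> norm (S t) \<le> C * exp (- a * t)"
    and pert: "\<And>\<psi> d t. \<psi> 0 = ?b \<Longrightarrow>
       (\<And>t. (\<psi> has_vector_derivative (A + B ** K) *v \<psi> t + (d \<bullet> \<psi> t) *\<^sub>R ?b) (at t)) \<Longrightarrow>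
       norm d < \<delta> \<Longrightarrow> t \<ge> 0 \<Longrightarrow> norm (\<psi> t - \<phi> t) \<le> C * norm d * exp (- a * t) \<and>
       norm (\<psi> t - \<phi> t - S t *v d) \<le> C * (norm d)\<^sup>2 * exp (- a * t)"
    by (rule perturbation_bounds[OF assms(5), of \<phi> ?b S])
      (use \<phi>0 d\<phi> S0 dS in \<open>simp_all add: column_def\<close>)
  \<comment> \<open>Cut off at 0 like the state itself, so that the identities for state and
    sensitivity hold at every time, including \<open>t \<le> 0\<close>.\<close>
  define \<phi>' where "\<phi>' t = (if t \<le> 0 then 0 else \<phi> t)" for t
  define S' where "S' t = (if t \<le> 0 then 0 else S t)" for t
  have c\<phi>': "continuous_on {0<..} \<phi>'"
    by (rule continuous_on_eq[OF continuous_on_has_vector_derivative[OF d\<phi>]]) (auto simp: \<phi>'_def)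
  have cS': "continuous_on {0<..} S'"
    by (rule continuous_on_eq[OF continuous_on_has_vector_derivative[OF dS]]) (auto simp: S'_def)
  have b\<phi>': "norm (\<phi>' t) \<le> C * exp (- a * t)" if "t > 0" for t
    using b\<phi>[of t] that by (simp add: \<phi>'_def)
  have bS': "norm (S' t) \<le> C * exp (- a * t)" if "t > 0" for t
    using bS[of t] that by (simp add: S'_def)
  have st': "state A B K t = columnvector (\<phi>' t)" for t
    by (simp add: st \<phi>'_def)
  have perturbed: "\<exists>\<psi>'. continuous_on {0<..} \<psi>' \<and> (\<forall>t. state A B (K + D) t = columnvector (\<psi>' t)) \<and>
      (\<forall>t. norm (\<psi>' t - \<phi>' t) \<le> C * norm D * exp (- a * t)) \<and>
      (\<forall>t. norm (\<psi>' t - \<phi>' t - S' t *v D $ 1) \<le> C * (norm D)\<^sup>2 * exp (- a * t))"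
    if D: "norm D < \<delta>" for D
  proof -
    obtain \<psi> where \<psi>0: "\<psi> 0 = ?b"
      and d\<psi>: "\<And>t. (\<psi> has_vector_derivative (A + B ** (K + D)) *v \<psi> t) (at t)"
      and st\<psi>: "state A B (K + D) = (\<lambda>t. if t \<le> 0 then 0 else columnvector (\<psi> t))"
      by (rule state_sensitivity[of B A "K + D"]) (rule that, assumption+)
    define \<psi>' where "\<psi>' t = (if t \<le> 0 then 0 else \<psi> t)" for t
    note p = pert[OF \<psi>0 d\<psi>[unfolded closed_loop_perturbation] D[unfolded norm_row_matrix]]
    have "continuous_on {0<..} \<psi>'"
      by (rule continuous_on_eq[OF continuous_on_has_vector_derivative[OF d\<psi>]]) (auto simp: \<psi>'_def)
    moreover have "norm (\<psi>' t - \<phi>' t) \<le> C * norm D * exp (- a * t)"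
      "norm (\<psi>' t - \<phi>' t - S' t *v D $ 1) \<le> C * (norm D)\<^sup>2 * exp (- a * t)" for t
      using p[of t] C by (auto simp: \<psi>'_def \<phi>'_def S'_def norm_row_matrix)
    ultimately show ?thesis
      by (intro exI[of _ \<psi>']) (auto simp: st\<psi> \<psi>'_def)
  qed
  have G: "GDERIV (\<lambda>K'. state A B K' t $ i $ 1) K :> rowvector (S' t $ i)" for i t
  proof (rule GDERIV_quadratic_bound[OF \<delta>])
    fix D :: "real^'n^1" assume "norm D < \<delta>"
    then obtain \<psi>' where \<psi>': "\<And>t. state A B (K + D) t = columnvector (\<psi>' t)"
      "\<And>t. norm (\<psi>' t - \<phi>' t - S' t *v D $ 1) \<le> C * (norm D)\<^sup>2 * exp (- a * t)"
      using perturbed by blast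
    have "state A B (K + D) t $ i $ 1 - state A B K t $ i $ 1 - D \<bullet> rowvector (S' t $ i)
        = (\<psi>' t - \<phi>' t - S' t *v D $ 1) $ i"
      by (simp add: \<psi>'(1) st' columnvector_def inner_row_matrix rowvector_def inner_commute
          matrix_vector_mul_component)
    then show "\<bar>state A B (K + D) t $ i $ 1 - state A B K t $ i $ 1 - D \<bullet> rowvector (S' t $ i)\<bar>
        \<le> C * exp (- a * t) * (norm D)\<^sup>2"
      using order_trans[OF component_le_norm_cart[of _ i] \<psi>'(2)[of t]] by (simp add: mult_ac)
  qed
  \<comment> \<open>The derivative \<open>G\<close> is unique, so the \<open>THE\<close> inside
    \<open>dstate\<close> evaluates to the rows of the cut-off sensitivity.\<close>
  have dx: "dx t = S' t" for t
    by (simp add: dx_def dstate_def gradient_eqI[OF G] vec_eq_iff rowvector_def)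
  have u: "u t = K $ 1 \<bullet> \<phi>' t" for t
    by (simp add: u_def feedback_def st' matrix_matrix_mult_def columnvector_def inner_vec_def)
  let ?P = "\<lambda>t. transpose (x t) ** Q ** dx t"
  let ?U = "\<lambda>t. (u t * R) *\<^sub>R (transpose (x t) + K ** dx t)"
  have P: "?P absolutely_integrable_on {0..}"
    unfolding x_def dx st'
    by (rule bilinear_exp_bound_integrable[OF bilinear_cross_cost a c\<phi>' cS' b\<phi>' bS'])
  have U: "?U absolutely_integrable_on {0..}"
  proof -
    have "norm (\<phi>' t, S' t) \<le> (2 * C) * exp (- a * t)" if "t > 0" for t
      using norm_Pair_le[of "\<phi>' t" "S' t"] b\<phi>'[OF that] bS'[OF that] by simp
    from bilinear_exp_bound_integrable[OF bilinear_control_cost[of "K $ 1" R K] a c\<phi>'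
        continuous_on_Pair[OF c\<phi>' cS'] b\<phi>' this]
    show ?thesis by (simp add: u x_def dx st')
  qed
  have rc: "running_cost A B Q R K' absolutely_integrable_on {0..}"
    if "continuous_on {0<..} f" "\<And>t. state A B K' t = columnvector (f t)"
      "\<And>t. t > 0 \<Longrightarrow> norm (f t) \<le> c * exp (- a * t)" for K' f c
    using bilinear_exp_bound_integrable[OF bilinear_running_cost[of Q R "K' $ 1"] a that(1) that(1) that(3) that(3)]
    by (simp add: running_cost_columnvector[OF that(2)] power2_eq_square cong: set_integrable_cong)
  have rcK: "running_cost A B Q R K absolutely_integrable_on {0..}"
    by (rule rc[OF c\<phi>' st' b\<phi>'])
  obtain q where q: "q > 0" "\<And>x y. \<bar>x \<bullet> (Q *v y)\<bar> \<le> q * norm x * norm y"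
  proof -
    have "bilinear (\<lambda>x y. x \<bullet> (Q *v y))"
      by (auto simp: bilinear_def linear_iff inner_add_left inner_add_right
          matrix_vector_right_distrib matrix_vector_mult_scaleR)
    then show thesis using that bilinear_bounded_pos by (metis real_norm_def)
  qed
  define k where "k = norm (K $ 1)"
  \<comment> \<open>The constant of \<open>running_cost_remainder\<close>, which depends on neither
    \<open>D\<close> nor \<open>t\<close>.\<close>
  define c where "c = 2 * q * C\<^sup>2 + \<bar>R\<bar> * (C * (k + 1 + \<delta>))\<^sup>2 + \<bar>R\<bar> * (k * C * (k * C + C))"
  have "GDERIV (cost A B Q R) K :> integral {0..} ?P + integral {0..} ?U"
  proof (rule GDERIV_quadratic_bound[OF \<delta>])
    fix D :: "real^'n^1" assume D: "norm D < \<delta>"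
    obtain \<psi>' where c\<psi>: "continuous_on {0<..} \<psi>'" and st\<psi>: "\<And>t. state A B (K + D) t = columnvector (\<psi>' t)"
      and e: "\<And>t. norm (\<psi>' t - \<phi>' t) \<le> C * norm D * exp (- a * t)"
      and \<rho>: "\<And>t. norm (\<psi>' t - \<phi>' t - S' t *v D $ 1) \<le> C * (norm D)\<^sup>2 * exp (- a * t)"
      using perturbed[OF D] by blast
    have rcD: "running_cost A B Q R (K + D) absolutely_integrable_on {0..}"
    proof (rule rc[OF c\<psi> st\<psi>])
      show "norm (\<psi>' t) \<le> (C + C * norm D) * exp (- a * t)" if "t > 0" for t
        using norm_triangle_sub[of "\<psi>' t" "\<phi>' t"] b\<phi>'[OF that] e[of t] by (simp add: algebra_simps)
    qed
    define r where "r t = running_cost A B Q R (K + D) t - running_cost A B Q R K t - D \<bullet> (?P t + ?U t)" for t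
    have PU: "(\<lambda>t. ?P t + ?U t) integrable_on {0..}"
      using P U by (intro integrable_add set_lebesgue_integral_eq_integral)
    have "integral {0..} r = cost A B Q R (K + D) - cost A B Q R K
        - D \<bullet> (integral {0..} ?P + integral {0..} ?U)"
    proof -
      have "integral {0..} (\<lambda>t. D \<bullet> (?P t + ?U t)) = D \<bullet> (integral {0..} ?P + integral {0..} ?U)"
        using integral_linear[OF PU bounded_linear_inner_right[of D]]
          integral_add[OF set_lebesgue_integral_eq_integral(1)[OF P] set_lebesgue_integral_eq_integral(1)[OF U]]
        by (simp add: o_def)
      moreover have "(\<lambda>t. D \<bullet> (?P t + ?U t)) integrable_on {0..}"
        using integrable_linear[OF PU bounded_linear_inner_right[of D]] by (simp add: o_def)
      ultimately show ?thesis
        using set_lebesgue_integral_eq_integral(1)[OF rcD] set_lebesgue_integral_eq_integral(1)[OF rcK]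
        unfolding r_def cost_def by (simp add: integral_diff integrable_diff)
    qed
    \<comment> \<open>The remainder is quadratic in the decaying quantities, so its rate is
      \<open>2 * a\<close>, and integration in time divides the constant by
      \<open>2 * a\<close>.\<close>
    moreover have "norm (integral {0..} r) \<le> c * (norm D)\<^sup>2 / (2 * a)"
    proof (rule absolutely_integrable_exp_bound(2))
      have r: "r t = 1/2 * (\<psi>' t \<bullet> (Q *v \<psi>' t) + R * ((K $ 1 + D $ 1) \<bullet> \<psi>' t)\<^sup>2)
          - 1/2 * (\<phi>' t \<bullet> (Q *v \<phi>' t) + R * (K $ 1 \<bullet> \<phi>' t)\<^sup>2)
          - (\<phi>' t \<bullet> (Q *v (S' t *v D $ 1)) + K $ 1 \<bullet> \<phi>' t * R * (D $ 1 \<bullet> \<phi>' t + K $ 1 \<bullet> (S' t *v D $ 1)))" for t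
        by (simp add: r_def running_cost_columnvector[OF st\<psi>] running_cost_columnvector[OF st']
            u x_def dx st' inner_add_right[of D "_ ** _"] inner_cross_cost inner_control_cost)
      show "continuous_on {0<..} r"
        unfolding r by (intro continuous_intros c\<psi> c\<phi>' cS' bounded_linear.continuous_on[OF matrix_vector_mul_bounded_linear]
            bounded_linear.continuous_on[OF bounded_linear_matrix_vector_mult_left])
      fix t :: real assume t: "t > 0"
      have "\<bar>r t\<bar> \<le> c * (norm (D $ 1))\<^sup>2 * (exp (- a * t))\<^sup>2"
        unfolding r c_def k_def
        by (rule running_cost_remainder)
          (use assms(1) q C D b\<phi>'[OF t] e[of t] \<rho>[of t] in
            \<open>auto simp: pos_semidef_def norm_row_matrix\<close>)
      then show "norm (r t) \<le> c * (norm D)\<^sup>2 * exp (- (2 * a) * t)"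
        by (simp add: norm_row_matrix power2_eq_square mult.assoc flip: exp_add)
    qed (use a in simp)
    ultimately show "\<bar>cost A B Q R (K + D) - cost A B Q R K - D \<bullet> (integral {0..} ?P + integral {0..} ?U)\<bar>
        \<le> c / (2 * a) * (norm D)\<^sup>2" by simp
  qed
  moreover have "transpose (impulse_response (\<lambda>s. A_plus A B K s ** complex_matrix B ** rowvector (axis i 1)
        ** A_plus A B K s ** complex_matrix B) t) = rowvector (S' t $ i)" for i t
    unfolding ir by (simp add: S'_def vec_eq_iff rowvector_def columnvector_def transpose_def)
  ultimately show ?thesis using G rcK P U by simp
qed

end
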